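(* Suppose $\psi=I_{\mathcal{C}}$ for a nonempty closed convex set $\mathcal{C}\subseteq\mathbb{R}^d$, $T=Kn$ with $K\in\mathbb{N}$, and the iterates $\boldsymbol{x}_1,\dots,\boldsymbol{x}_{T+1}$ are produced by the General Proximal Gradient Method under the Single Shuffle ($\mathsf{SS}$) sampling scheme with stepsizes $\eta_t=\frac{\eta}{\sqrt{T}}$ for all $t\in[T]$, where $\eta>0$. Then for any $\boldsymbol{z}\in\mathbb{R}^d$, $$\mathbb{E}[F(\boldsymbol{x}_{Kn+1})-F(\boldsymbol{z})]\le O\left(\left(\frac{\|\boldsymbol{z}-\boldsymbol{x}_1\|^2}{\eta}+\eta\left(\sqrt{nK}\,G_{f,1}G_{f,2}\land nG_{f,1}^2\right)(1+\log (nK))\right)\frac{1}{\sqrt{nK}}\right).$$ Set $\eta=\frac{\|\boldsymbol{z}-\boldsymbol{x}_1\|}{\sqrt{\left(\sqrt{nK}\,G_{f,1}G_{f,2}\land nG_{f,1}^2\right)(1+\log (nK))}}$ to optimize the dependence on parameters.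
   Context: Notation: $\mathbb{N}=\{1,2,\dots\}$, $[m]=\{1,\dots,m\}$, $a\land b=\min\{a,b\}$, $\|\cdot\|$ and $\langle\cdot,\cdot\rangle$ are the Euclidean norm and inner product on $\mathbb{R}^d$, $\mathrm{dom}\,h=\{\boldsymbol{x}:h(\boldsymbol{x})<+\infty\}$, $\partial h(\boldsymbol{x})$ is the convex subdifferential and $\nabla h(\boldsymbol{x})$ denotes an element of $\partial h(\boldsymbol{x})$. $I_{\mathcal{C}}(\boldsymbol{x})=0$ if $\boldsymbol{x}\in\mathcal{C}$ and $+\infty$ otherwise. $O(\cdot)$ hides an absolute constant. Problem: $F=f+\psi$ with $f=\frac1n\sum_{i=1}^n f_i$, each $f_i:\mathbb{R}^d\to\mathbb{R}$ convex. Each $f_i$ is $G_i$-Lipschitz on $\mathrm{dom}\,\psi=\mathcal{C}$ for some $G_i>0$. For every $i\in[n]$ and $\boldsymbol{x}\in\mathbb{R}^d$, $\nabla f_i(\boldsymbol{x})$ is deterministically picked from $\partial f_i(\boldsymbol{x})$. Put $G_{f,1}=\frac1n\sum_{i=1}^nG_i$ and $G_{f,2}=\sqrt{\frac1n\sum_{i=1}^nG_i^2}$. General Proximal Gradient Method: given an initial point $\boldsymbol{x}_1\in\mathrm{dom}\,\psi$ and stepsizes $\eta_t>0$, $t\in[T]$, for $t=1,\dots,T$ generate an index $\mathsf{i}(t)\in[n]$ and set $$\boldsymbol{x}_{t+1}=\mathrm{argmin}_{\boldsymbol{x}\in\mathbb{R}^d}\ \psi(\boldsymbol{x})+\langle\nabla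 f_{\mathsf{i}(t)}(\boldsymbol{x}_t),\boldsymbol{x}\rangle+\frac{\|\boldsymbol{x}-\boldsymbol{x}_t\|^2}{2\eta_t}.$$ For $t\in\mathbb{N}$, $\mathsf{r}(t)=t-(\lceil t/n\rceil-1)n\in[n]$. $\mathsf{SS}$ sampling scheme: $\mathsf{i}(t)=\pi^{\mathsf{r}(t)}$ where $\pi=(\pi^1,\dots,\pi^n)$ is a single uniformly random permutation of $[n]$.
   Formalization: Besides each f_i being G_i-Lipschitz on C, the picked subgradients are assumed to satisfy ‖∇f_i(x)‖ ≤ G_i for x in C; without this the claim fails, since a subgradient picked at a boundary point of C can be arbitrarily long. *)

theory Defs
  imports "HOL-Analysis.Analysis" "HOL-Probability.Probability"
begin

text \<open>
  The \<open>O\<close>-constant is absolute, hence also independent of the dimension, so the dimension has to be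
  quantified inside the formula, below the existential quantifier for that constant. For this
  reason \<open>\<real>\<^sup>d\<close> is not a type here but the subspace \<open>Rd d\<close> of the inner product space
  of finitely supported real sequences in which only the coordinates \<open>0, \<dots>, d - 1\<close> may be nonzero.
  \<open>Rd d\<close> is a closed subspace, so \<open>closed\<close> means the same for its subsets in both spaces.
\<close>

typedef finseq = "{x :: nat \<Rightarrow> real. finite {i. x i \<noteq> 0}}"
  morphisms coord Abs_finseq
  by (rule exI[of _ "\<lambda>_. 0"]) simp

setup_lifting type_definition_finseq

lemma finite_support: "finite {i. coord x i \<noteq> 0}"
  using coord[of x] by simp

lemma finseq_eqI: "(\<And>i. coord x i = coord y i) \<Longrightarrow> x = y"
  by (simp add: coord_inject[symmetric] fun_eq_iff)

instantiation finseq :: real_inner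
begin

lift_definition zero_finseq :: finseq is "\<lambda>_. 0" by simp

lift_definition plus_finseq :: "finseq \<Rightarrow> finseq \<Rightarrow> finseq" is "\<lambda>x y i. x i + y i"
  by (erule (1) finite_subset[OF _ finite_UnI, rotated]) auto

lift_definition uminus_finseq :: "finseq \<Rightarrow> finseq" is "\<lambda>x i. - x i" by simp

lift_definition minus_finseq :: "finseq \<Rightarrow> finseq \<Rightarrow> finseq" is "\<lambda>x y i. x i - y i"
  by (erule (1) finite_subset[OF _ finite_UnI, rotated]) auto

lift_definition scaleR_finseq :: "real \<Rightarrow> finseq \<Rightarrow> finseq" is "\<lambda>c x i. c * x i"
  by (erule finite_subset[rotated]) auto

definition inner_finseq :: "finseq \<Rightarrow> finseq \<Rightarrow> real" where
  "inner_finseq x y = (\<Sum>i | coord x i \<noteq> 0. coord x i * coord y i)"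

definition norm_finseq :: "finseq \<Rightarrow> real" where
  "norm_finseq x = sqrt (inner x x)"

definition sgn_finseq :: "finseq \<Rightarrow> finseq" where
  "sgn_finseq x = scaleR (inverse (norm x)) x"

definition dist_finseq :: "finseq \<Rightarrow> finseq \<Rightarrow> real" where
  "dist_finseq x y = norm (x - y)"

definition uniformity_finseq :: "(finseq \<times> finseq) filter" where
  "uniformity_finseq = (INF e\<in>{0<..}. principal {(x, y). dist x y < e})"

definition open_finseq :: "finseq set \<Rightarrow> bool" where
  "open_finseq U \<longleftrightarrow> (\<forall>x\<in>U. \<forall>\<^sub>F (x', y) in uniformity. x' = x \<longrightarrow> y \<in> U)"

lemma inner_finseq_superset:
  assumes "finite A" "{i. coord x i \<noteq> 0} \<subseteq> A"
  shows "inner x y = (\<Sum>i\<in>A. coord x i * coord y i)"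
  unfolding inner_finseq_def by (rule sum.mono_neutral_left) (use assms in auto)

instance
proof
  fix x y z :: finseq and r s :: real
  show "x + y + z = x + (y + z)" "x + y = y + x" "0 + x = x" "- x + x = 0" "x - y = x + - y"
    "r *\<^sub>R (x + y) = r *\<^sub>R x + r *\<^sub>R y" "(r + s) *\<^sub>R x = r *\<^sub>R x + s *\<^sub>R x"
    "r *\<^sub>R s *\<^sub>R x = (r * s) *\<^sub>R x" "1 *\<^sub>R x = x"
    by (transfer; simp add: fun_eq_iff algebra_simps)+
  let ?A = "{i. coord x i \<noteq> 0} \<union> {i. coord y i \<noteq> 0}"
  have fin: "finite ?A"
    using finite_support by simp
  have sub: "{i. coord x i \<noteq> 0} \<subseteq> ?A" "{i. coord y i \<noteq> 0} \<subseteq> ?A"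
    "{i. coord (x + y) i \<noteq> 0} \<subseteq> ?A" "{i. coord (r *\<^sub>R x) i \<noteq> 0} \<subseteq> ?A"
    by (auto simp: plus_finseq.rep_eq scaleR_finseq.rep_eq)
  note I = inner_finseq_superset[OF fin]
  show "inner x y = inner y x"
    by (simp add: I[OF sub(1)] I[OF sub(2)] mult.commute)
  show "inner (x + y) z = inner x z + inner y z"
    by (simp add: I[OF sub(1)] I[OF sub(2)] I[OF sub(3)] plus_finseq.rep_eq
        sum.distrib distrib_right)
  show "inner (r *\<^sub>R x) y = r * inner x y"
    by (simp add: I[OF sub(1)] I[OF sub(4)] scaleR_finseq.rep_eq sum_distrib_left mult.assoc)
  show "0 \<le> inner x x"
    unfolding inner_finseq_def by (rule sum_nonneg) simp
  show "inner x x = 0 \<longleftrightarrow> x = 0"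
  proof
    assume "inner x x = 0"
    then have "\<forall>i\<in>{i. coord x i \<noteq> 0}. coord x i * coord x i = 0"
      unfolding inner_finseq_def by (subst (asm) sum_nonneg_eq_0_iff) (auto simp: finite_support)
    then have "coord x i = coord 0 i" for i
      by (auto simp: zero_finseq.rep_eq)
    then show "x = 0"
      by (rule finseq_eqI)
  qed (simp add: inner_finseq_def zero_finseq.rep_eq)
  show "norm x = sqrt (inner x x)"
    by (rule norm_finseq_def)
  show "sgn x = scaleR (inverse (norm x)) x"
    by (rule sgn_finseq_def)
  show "dist x y = norm (x - y)"
    by (rule dist_finseq_def)
  show "uniformity = (INF e\<in>{0<..}. principal {(x :: finseq, y). dist x y < e})"
    by (rule uniformity_finseq_def)
  show "open U = (\<forall>x\<in>U. \<forall>\<^sub>F (x', y) in uniformity. x' = x \<longrightarrow> y \<in> U)" for U :: "finseq set"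
    by (rule open_finseq_def)
qed

end

definition Rd :: "nat \<Rightarrow> finseq set" where
  "Rd d = {x. \<forall>i\<ge>d. coord x i = 0}"

lemma inner_Rd:
  assumes "x \<in> Rd d"
  shows "inner x y = (\<Sum>i<d. coord x i * coord y i)"
  by (rule inner_finseq_superset) (use assms in \<open>auto simp: Rd_def not_le[symmetric]\<close>)

definition subdifferential :: "nat \<Rightarrow> (finseq \<Rightarrow> real) \<Rightarrow> finseq \<Rightarrow> finseq set" where
  "subdifferential d h x = {v \<in> Rd d. \<forall>y\<in>Rd d. h y \<ge> h x + inner v (y - x)}"

definition effective_domain :: "nat \<Rightarrow> (finseq \<Rightarrow> ereal) \<Rightarrow> finseq set" where
  "effective_domain d h = {x \<in> Rd d. h x < \<infinity>}"

definition convex_indicator :: "finseq set \<Rightarrow> finseq \<Rightarrow> ereal" where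
  "convex_indicator C x = (if x \<in> C then 0 else \<infinity>)"

definition objective :: "nat \<Rightarrow> (nat \<Rightarrow> finseq \<Rightarrow> real) \<Rightarrow> (finseq \<Rightarrow> ereal) \<Rightarrow> finseq \<Rightarrow> ereal" where
  "objective n f \<psi> x = ereal ((\<Sum>i=1..n. f i x) / real n) + \<psi> x"

text \<open>
  \<open>proximal_gradient d \<psi> g ix \<eta> T x\<close>: the points \<open>x 1, \<dots>, x (T + 1)\<close> form a run of the method on
  \<open>Rd d\<close>, where \<open>g i y\<close> is the selected subgradient of the \<open>i\<close>-th component at \<open>y\<close>,
  \<open>ix t\<close> the index used in step \<open>t\<close> and \<open>\<eta> t\<close> the stepsize. The minimiser in each step is unique
  for convex \<open>\<psi>\<close>, since the objective is then strongly convex.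
\<close>

definition proximal_gradient ::
  "nat \<Rightarrow> (finseq \<Rightarrow> ereal) \<Rightarrow> (nat \<Rightarrow> finseq \<Rightarrow> finseq) \<Rightarrow> (nat \<Rightarrow> nat) \<Rightarrow> (nat \<Rightarrow> real) \<Rightarrow> nat
    \<Rightarrow> (nat \<Rightarrow> finseq) \<Rightarrow> bool" where
  "proximal_gradient d \<psi> g ix \<eta> T x \<longleftrightarrow>
     x 1 \<in> effective_domain d \<psi> \<and>
     (\<forall>t\<in>{1..T}.
        is_arg_min
          (\<lambda>y. \<psi> y + ereal (inner (g (ix t) (x t)) y) + ereal ((norm (y - x t))\<^sup>2 / (2 * \<eta> t)))
          (\<lambda>y. y \<in> Rd d) (x (t + 1)))"

definition cyclic_index :: "nat \<Rightarrow> nat \<Rightarrow> nat" where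
  "cyclic_index n t = nat (int t - (\<lceil>real t / real n\<rceil> - 1) * int n)"

definition single_shuffle :: "nat \<Rightarrow> (nat \<Rightarrow> nat) \<Rightarrow> nat \<Rightarrow> nat" where
  "single_shuffle n \<pi> t = \<pi> (cyclic_index n t)"

definition uniform_permutation :: "nat \<Rightarrow> (nat \<Rightarrow> nat) pmf" where
  "uniform_permutation n = pmf_of_set {\<pi>. \<pi> permutes {1..n}}"

text \<open>
  Lebesgue expectation of an extended-real random variable, as the difference of the expectations
  of its positive and negative parts (\<open>e2ennreal\<close> maps negative numbers to \<open>0\<close>).
\<close>

definition ereal_expectation :: "'a measure \<Rightarrow> ('a \<Rightarrow> ereal) \<Rightarrow> ereal" where
  "ereal_expectation M X =
     enn2ereal (\<integral>\<^sup>+ \<omega>. e2ennreal (X \<omega>) \<partial>M) - enn2ereal (\<integral>\<^sup>+ \<omega>. e2ennreal (- X \<omega>) \<partial>M)"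

definition G_f1 :: "nat \<Rightarrow> (nat \<Rightarrow> real) \<Rightarrow> real" where
  "G_f1 n G = (\<Sum>i=1..n. G i) / real n"

definition G_f2 :: "nat \<Rightarrow> (nat \<Rightarrow> real) \<Rightarrow> real" where
  "G_f2 n G = sqrt ((\<Sum>i=1..n. (G i)\<^sup>2) / real n)"

definition ss_factor :: "nat \<Rightarrow> nat \<Rightarrow> (nat \<Rightarrow> real) \<Rightarrow> real" where
  "ss_factor n K G =
     min (sqrt (real (n * K)) * G_f1 n G * G_f2 n G) (real n * (G_f1 n G)\<^sup>2)
     * (1 + ln (real (n * K)))"

definition ss_rate :: "nat \<Rightarrow> nat \<Rightarrow> (nat \<Rightarrow> real) \<Rightarrow> real \<Rightarrow> real \<Rightarrow> real" where
  "ss_rate n K G D \<eta> = (D\<^sup>2 / \<eta> + \<eta> * ss_factor n K G) * (1 / sqrt (real (n * K)))"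

end

theory Submission
  imports Defs
begin

text \<open>
  For the indicator of \<open>C\<close> the method is the projected subgradient method with constant stepsize
  \<open>h = \<eta> / sqrt (n K)\<close>. The two terms of the minimum in the rate come from two independent
  arguments, both of which compare the tail of a run with one of its own iterates: if, from every
  start \<open>s\<close> on, the values \<open>a t\<close> exceed \<open>a s\<close> by at most \<open>E\<close> on average, then the last value exceeds
  the overall average by at most \<open>E\<close> times a harmonic number (\<open>last_le_average_plus_harm\<close>). This is the
  origin of the logarithm.

  The term \<open>n G1\<^sup>2\<close> holds for every order. During one pass the iterates move by at most \<open>h n G1\<close>, so
  every component can be evaluated at the start of the pass with little loss, and a whole pass is a
  subgradient step for \<open>F\<close> of length \<open>n h\<close> with error \<open>O (h\<^sup>2 (n G1)\<^sup>2)\<close> (\<open>pass_descent\<close>). The values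
  of \<open>F\<close> at the pass boundaries then satisfy the tail condition.

  The term \<open>sqrt (n K) G1 G2\<close> needs the average over the order, because the component
  \<open>f (\<pi> p)\<close> used in a step is correlated with the iterate. Exchanging two positions \<open>p\<close> and \<open>q\<close> of
  \<open>\<pi>\<close> is a bijection on permutations, so the difference between the averages of \<open>f (\<pi> p)\<close> and of
  \<open>F\<close> at an iterate is the average effect of such an exchange on the iterate (\<open>component_vs_mean\<close>).
  The effect is small (\<open>swap_stability\<close>): steps with the same component enlarge the squared distance
  of the two runs by at most \<open>(2 h G i)\<^sup>2\<close> since subgradients are monotone, and only \<open>2 K\<close> steps use
  different components. This gives an error of order \<open>h (sqrt (n K) G1 G2 + K G2\<^sup>2)\<close>, for any
  iterate and any position, in particular also for iterates used as reference points. The extra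
  \<open>K G2\<^sup>2\<close> is dominated by \<open>sqrt (n K) G1 G2\<close> exactly when \<open>sqrt (n K) G1 G2\<close> is the smaller term of
  the minimum, so it can be absorbed (\<open>average_bound_min\<close>).
\<close>


section \<open>From regret over final segments to the last iterate\<close>

lemma harm_le_one_plus_ln:
  assumes "n \<ge> 1"
  shows "harm n \<le> 1 + ln (real n)"
  using euler_mascheroni_sequence_decreasing[of 1 n] assms by (simp add: harm_expand)

text \<open>
  Let \<open>S k / k\<close> be the average of the last \<open>k\<close> values. The tail condition at the first of the last
  \<open>k + 1\<close> values says that this value is at least \<open>S (k + 1) / (k + 1) - E\<close>, so dropping it raises
  the average by at most \<open>E / k\<close>. Going from all \<open>N\<close> values down to the last one adds up to the
  harmonic sum.
\<close>

lemma last_le_average_plus_harm: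
  fixes a :: "nat \<Rightarrow> real"
  assumes "N \<ge> 1"
    and tail: "\<And>s. s \<in> {1..N} \<Longrightarrow> (\<Sum>t=s..N. a t - a s) \<le> real (N - s + 1) * E"
  shows "a N \<le> (\<Sum>t=1..N. a t) / real N + E * harm (N - 1)"
proof -
  define S where "S k = (\<Sum>t=N+1-k..N. a t)" for k
  have "a N \<le> S k / real k + E * harm (k - 1)" if "k \<ge> 1" "k \<le> N" for k
    using that
  proof (induction k rule: dec_induct)
    case base
    then show ?case by (simp add: S_def harm_def)
  next
    case (step k)
    have k: "0 < k" "k < N" using step by auto
    have S: "S (Suc k) = S k + a (N - k)"
    proof -
      have "{N + 1 - Suc k..N} = insert (N - k) {N + 1 - k..N}" "N - k \<notin> {N + 1 - k..N}"
        using k by auto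
      then show ?thesis by (simp add: S_def)
    qed
    have "(\<Sum>t=N-k..N. a t - a (N - k)) \<le> real (N - (N - k) + 1) * E"
      using k by (intro tail) auto
    moreover have "(\<Sum>t=N-k..N. a t - a (N - k)) = S (Suc k) - (real k + 1) * a (N - k)"
      using k by (simp add: sum_subtractf S_def)
    ultimately have "S (Suc k) - (real k + 1) * a (N - k) \<le> (real k + 1) * E"
      using k by (simp add: add.commute)
    then have "(real k + 1) * (S k - E) \<le> real k * S (Suc k)"
      unfolding S by (simp add: algebra_simps)
    then have "S k - E \<le> real k * (S (Suc k) / real (Suc k))"
      using k by (simp add: field_simps)
    then have "(S k - E) / real k \<le> S (Suc k) / real (Suc k)"
      using k by (simp add: pos_divide_le_eq mult.commute)
    moreover have "harm k = harm (k - 1) + 1 / real k"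
      using k harm_Suc[of "k - 1", where 'a=real] by (simp add: inverse_eq_divide)
    ultimately show ?case
      using step.IH k by (simp add: distrib_left diff_divide_distrib)
  qed
  from this[of N] show ?thesis
    using assms(1) by (simp add: S_def)
qed

lemma last_iterate_bound:
  fixes a :: "nat \<Rightarrow> real"
  assumes "N \<ge> 1" "E \<ge> 0"
    and tail: "\<And>s. s \<in> {1..N} \<Longrightarrow> (\<Sum>t=s..N. a t - a s) \<le> real (N - s + 1) * E"
    and average: "(\<Sum>t=1..N. a t - b) \<le> D + real N * E"
  shows "a N - b \<le> D / real N + 2 * E * (1 + ln (real N))"
proof -
  have "harm (N - 1) \<le> (harm N :: real)"
    by (intro harm_mono) simp
  also have "\<dots> \<le> 1 + ln (real N)"
    by (rule harm_le_one_plus_ln) fact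
  finally have "E * harm (N - 1) \<le> E * (1 + ln (real N))"
    using assms(2) by (intro mult_left_mono)
  moreover have "(\<Sum>t=1..N. a t) / real N - b \<le> D / real N + E"
    using divide_right_mono[OF average, of "real N"] assms(1)
    by (simp add: sum_subtractf diff_divide_distrib add_divide_distrib)
  moreover have "E \<le> E * (1 + ln (real N))"
    using assms(1,2) mult_left_mono[of 1 "1 + ln (real N)" E] by simp
  ultimately show ?thesis
    using last_le_average_plus_harm[of N a E] assms(1) tail by (simp add: algebra_simps)
qed


section \<open>Projected subgradient steps\<close>

text \<open>
  Projection is characterised by its variational inequality: this avoids any completeness assumption
  on the space, and the run of the method supplies the projected points.
\<close>

definition is_projection :: "'a::real_inner set \<Rightarrow> 'a \<Rightarrow> 'a \<Rightarrow> bool" where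
  "is_projection C v p \<longleftrightarrow> p \<in> C \<and> (\<forall>u\<in>C. inner (v - p) (u - p) \<le> 0)"

lemma is_projection_self: "u \<in> C \<Longrightarrow> is_projection C u u"
  by (simp add: is_projection_def)

lemma is_projection_nonexpansive:
  assumes "is_projection C v p" "is_projection C w q"
  shows "norm (p - q) \<le> norm (v - w)"
proof -
  have "inner (v - p) (q - p) \<le> 0" "inner (w - q) (p - q) \<le> 0"
    using assms by (auto simp: is_projection_def)
  then have "(norm (p - q))\<^sup>2 \<le> inner (v - w) (p - q)"
    by (simp add: power2_norm_eq_inner algebra_simps inner_commute)
  also have "\<dots> \<le> norm (v - w) * norm (p - q)"
    by (rule norm_cauchy_schwarz)
  finally have "norm (p - q) * norm (p - q) \<le> norm (v - w) * norm (p - q)"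
    by (simp add: power2_eq_square)
  then show ?thesis
    by (cases "p = q") auto
qed

lemma closest_point_is_projection:
  assumes "convex C" "p \<in> C" and closest: "\<And>u. u \<in> C \<Longrightarrow> norm (p - v) \<le> norm (u - v)"
  shows "is_projection C v p"
  unfolding is_projection_def
proof (intro conjI ballI, fact)
  fix u assume "u \<in> C"
  show "inner (v - p) (u - p) \<le> 0"
  proof (rule ccontr)
    assume "\<not> ?thesis"
    then obtain r where r: "0 < r" "r \<le> 1" "dist (p + r *\<^sub>R (u - p)) v < dist p v"
      using closer_point_lemma[of v p u] by auto
    have "(1 - r) *\<^sub>R p + r *\<^sub>R u \<in> C"
      using r assms(1,2) \<open>u \<in> C\<close> by (intro convexD) auto
    then have "p + r *\<^sub>R (u - p) \<in> C"
      by (simp add: algebra_simps)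
    then show False
      using closest r(3) by (fastforce simp: dist_norm)
  qed
qed

text \<open>
  Completing the square turns the proximal objective, up to a constant and the factor \<open>2 h\<close>, into
  the squared distance from \<open>y - h *\<^sub>R v\<close>.
\<close>

lemma prox_indicator_is_projection:
  assumes "convex C" "C \<subseteq> Rd d" "y \<in> C" "h > 0"
    and "is_arg_min (\<lambda>u. convex_indicator C u + ereal (inner v u)
           + ereal ((norm (u - y))\<^sup>2 / (2 * h))) (\<lambda>u. u \<in> Rd d) p"
  shows "is_projection C (y - h *\<^sub>R v) p"
proof -
  have no_better: "\<not> convex_indicator C u + ereal (inner v u) + ereal ((norm (u - y))\<^sup>2 / (2 * h))
      < convex_indicator C p + ereal (inner v p) + ereal ((norm (p - y))\<^sup>2 / (2 * h))"
    if "u \<in> C" for u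
    using assms(2,5) that unfolding is_arg_min_def by blast
  have p: "p \<in> C"
    using no_better[OF assms(3)] assms(3) by (auto simp: convex_indicator_def split: if_splits)
  show ?thesis
  proof (rule closest_point_is_projection[OF assms(1) p])
    fix u assume u: "u \<in> C"
    have complete_square: "(norm (w - (y - h *\<^sub>R v)))\<^sup>2
        = 2 * h * (inner v w + (norm (w - y))\<^sup>2 / (2 * h)) - 2 * h * inner v y + (norm (h *\<^sub>R v))\<^sup>2"
      for w
    proof -
      have "(norm (w - y + h *\<^sub>R v))\<^sup>2
          = (norm (w - y))\<^sup>2 + 2 * h * inner v (w - y) + (norm (h *\<^sub>R v))\<^sup>2"
        unfolding power2_norm_eq_inner by (simp add: inner_add inner_commute)
      then show ?thesis
        using assms(4) by (simp add: algebra_simps)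
    qed
    have "inner v p + (norm (p - y))\<^sup>2 / (2 * h) \<le> inner v u + (norm (u - y))\<^sup>2 / (2 * h)"
      using no_better[OF u] u p by (simp add: convex_indicator_def not_less)
    then have "(norm (p - (y - h *\<^sub>R v)))\<^sup>2 \<le> (norm (u - (y - h *\<^sub>R v)))\<^sup>2"
      unfolding complete_square using assms(4) by (intro add_right_mono diff_right_mono mult_left_mono) auto
    then show "norm (p - (y - h *\<^sub>R v)) \<le> norm (u - (y - h *\<^sub>R v))"
      by simp
  qed
qed


lemma proximal_gradient_indicator:
  assumes "convex C" "C \<subseteq> Rd d" "h > 0"
    and prox_run: "proximal_gradient d (convex_indicator C) g ix (\<lambda>_. h) N x"
  shows "x 1 \<in> C"
    and "t \<in> {1..N} \<Longrightarrow> is_projection C (x t - h *\<^sub>R g (ix t) (x t)) (x (t + 1))"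
proof -
  show x1: "x 1 \<in> C"
    using prox_run
    by (auto simp: proximal_gradient_def effective_domain_def convex_indicator_def split: if_splits)
  have projection_step: "is_projection C (x t - h *\<^sub>R g (ix t) (x t)) (x (t + 1))"
    if "t \<in> {1..N}" "x t \<in> C" for t
    using prox_run that unfolding proximal_gradient_def
    by (intro prox_indicator_is_projection[OF assms(1,2) that(2) assms(3)]) auto
  have in_C: "x t \<in> C" if "1 \<le> t" "t \<le> N + 1" for t
    using that
  proof (induction t rule: dec_induct)
    case (step t)
    then show ?case
      using projection_step[of t] by (simp add: is_projection_def)
  qed (rule x1)
  show "is_projection C (x t - h *\<^sub>R g (ix t) (x t)) (x (t + 1))" if "t \<in> {1..N}"
    using that by (intro projection_step in_C) auto
qed


section \<open>Cyclic passes over the components\<close>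

lemma cyclic_index_add:
  assumes "j \<in> {1..n}"
  shows "cyclic_index n (k * n + j) = j"
proof -
  have "\<lceil>real (k * n + j) / real n\<rceil> = int k + 1"
  proof (rule ceiling_unique)
    show "of_int (int k + 1) - 1 < real (k * n + j) / real n"
      using assms by (simp add: field_simps)
    show "real (k * n + j) / real n \<le> of_int (int k + 1)"
      using assms by (simp add: field_simps flip: of_nat_mult)
  qed
  then show ?thesis
    by (simp add: cyclic_index_def)
qed

lemma cyclic_index_range:
  assumes "n \<ge> 1" "t \<ge> 1"
  shows "cyclic_index n t \<in> {1..n}"
proof -
  have "(t - 1) mod n + 1 \<in> {1..n}"
    using assms by (simp add: Suc_leI)
  moreover have "t = (t - 1) div n * n + ((t - 1) mod n + 1)"
    using assms(2) div_mult_mod_eq[of "t - 1" n] by linarith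
  ultimately show ?thesis
    using cyclic_index_add by metis
qed

lemma sum_one_pass:
  "(\<Sum>t=k*n+1..<k*n+1+n. \<phi> (cyclic_index n t)) = (\<Sum>j=1..n. \<phi> j)"
proof -
  have "(\<Sum>t=k*n+1..<k*n+1+n. \<phi> (cyclic_index n t))
      = (\<Sum>j=1..<1+n. \<phi> (cyclic_index n (j + k * n)))"
    using sum.shift_bounds_nat_ivl[of "\<lambda>t. \<phi> (cyclic_index n t)" 1 "k * n" "1 + n"]
    by (simp add: ac_simps)
  also have "\<dots> = (\<Sum>j=1..n. \<phi> j)"
    proof (rule sum.cong)
    fix j assume "j \<in> {1..n}"
    from cyclic_index_add[OF this, of k] show "\<phi> (cyclic_index n (j + k * n)) = \<phi> j"
      by (simp add: add.commute)
  qed auto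
  finally show ?thesis .
qed

lemma sum_cyclic_passes:
  fixes \<phi> :: "nat \<Rightarrow> real"
  shows "(\<Sum>t=1..<K*n+1. \<phi> (cyclic_index n t)) = real K * (\<Sum>j=1..n. \<phi> j)"
proof (induction K)
  case (Suc K)
  have "(\<Sum>t=1..<Suc K*n+1. \<phi> (cyclic_index n t)) =
      (\<Sum>t=1..<K*n+1. \<phi> (cyclic_index n t)) + (\<Sum>t=K*n+1..<K*n+1+n. \<phi> (cyclic_index n t))"
    using sum.atLeastLessThan_concat[of 1 "K*n+1" "K*n+1+n" "\<lambda>t. \<phi> (cyclic_index n t)"]
    by (simp add: ac_simps)
  then show ?case
    unfolding Suc.IH sum_one_pass by (simp add: algebra_simps)
qed simp


section \<open>Averages over all permutations\<close>

definition perm_avg :: "nat \<Rightarrow> ((nat \<Rightarrow> nat) \<Rightarrow> real) \<Rightarrow> real" where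
  "perm_avg n X = (\<Sum>\<pi> | \<pi> permutes {1..n}. X \<pi>) / real (card {\<pi>. \<pi> permutes {1..n}})"

lemma finite_perms: "finite {\<pi>. \<pi> permutes {1..n::nat}}"
  by (simp add: finite_permutations)

lemma card_perms_pos: "card {\<pi>. \<pi> permutes {1..n::nat}} > 0"
  by (subst card_permutations[OF refl]) simp_all

lemma perm_avg_add: "perm_avg n (\<lambda>\<pi>. X \<pi> + Y \<pi>) = perm_avg n X + perm_avg n Y"
  by (simp add: perm_avg_def sum.distrib add_divide_distrib)

lemma perm_avg_diff: "perm_avg n (\<lambda>\<pi>. X \<pi> - Y \<pi>) = perm_avg n X - perm_avg n Y"
  by (simp add: perm_avg_def sum_subtractf diff_divide_distrib)

lemma perm_avg_cmult: "perm_avg n (\<lambda>\<pi>. c * X \<pi>) = c * perm_avg n X"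
  by (simp add: perm_avg_def sum_distrib_left)

lemma perm_avg_const: "perm_avg n (\<lambda>_. c) = c"
  using card_perms_pos[of n] by (simp add: perm_avg_def)

lemma perm_avg_sum: "perm_avg n (\<lambda>\<pi>. \<Sum>i\<in>A. X i \<pi>) = (\<Sum>i\<in>A. perm_avg n (X i))"
  unfolding perm_avg_def sum_divide_distrib by (rule sum.swap)

lemma perm_avg_mono:
  "(\<And>\<pi>. \<pi> permutes {1..n} \<Longrightarrow> X \<pi> \<le> Y \<pi>) \<Longrightarrow> perm_avg n X \<le> perm_avg n Y"
  by (auto simp: perm_avg_def intro!: divide_right_mono sum_mono)

lemma perm_avg_cong:
  "(\<And>\<pi>. \<pi> permutes {1..n} \<Longrightarrow> X \<pi> = Y \<pi>) \<Longrightarrow> perm_avg n X = perm_avg n Y"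
  by (auto simp: perm_avg_def)

text \<open>
  Composition with a transposition permutes the set over which the average is taken. All the
  randomness of the shuffle enters through this invariance.
\<close>

lemma perm_avg_swap:
  assumes "p \<in> {1..n}" "q \<in> {1..n}"
  shows "perm_avg n (\<lambda>\<pi>. X (\<pi> \<circ> Transposition.transpose p q)) = perm_avg n X"
  using sum_permutations_compose_right[OF permutes_swap_id[OF assms], of X]
  by (simp add: perm_avg_def)

lemma perm_avg_component:
  assumes "p \<in> {1..n}"
  shows "perm_avg n (\<lambda>\<pi>. \<phi> (\<pi> p)) = (\<Sum>i=1..n. \<phi> i) / real n"
proof -
  have "real n * perm_avg n (\<lambda>\<pi>. \<phi> (\<pi> p)) = (\<Sum>q=1..n. perm_avg n (\<lambda>\<pi>. \<phi> (\<pi> q)))"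
  proof -
    have "perm_avg n (\<lambda>\<pi>. \<phi> (\<pi> q)) = perm_avg n (\<lambda>\<pi>. \<phi> (\<pi> p))" if "q \<in> {1..n}" for q
      using perm_avg_swap[OF assms that, of "\<lambda>\<pi>. \<phi> (\<pi> p)"] by simp
    then show ?thesis by simp
  qed
  also have "\<dots> = perm_avg n (\<lambda>\<pi>. \<Sum>q=1..n. \<phi> (\<pi> q))"
    by (rule perm_avg_sum[symmetric])
  also have "\<dots> = perm_avg n (\<lambda>_. \<Sum>i=1..n. \<phi> i)"
  proof (rule perm_avg_cong)
    fix \<pi> assume "\<pi> permutes {1..n}"
    from sum.permute[OF this, of \<phi>] show "(\<Sum>q=1..n. \<phi> (\<pi> q)) = (\<Sum>i=1..n. \<phi> i)"
      by (simp add: comp_def)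
  qed
  also have "\<dots> = (\<Sum>i=1..n. \<phi> i)"
    by (rule perm_avg_const)
  finally show ?thesis
    using assms by (simp add: field_simps)
qed

lemma ereal_expectation_uniform_permutation:
  assumes "\<And>\<pi>. \<pi> permutes {1..n} \<Longrightarrow> X \<pi> = ereal (r \<pi>)"
  shows "ereal_expectation (measure_pmf (uniform_permutation n)) X = ereal (perm_avg n r)"
proof -
  let ?P = "{\<pi>. \<pi> permutes {1..n}}"
  have ne: "?P \<noteq> {}"
    using card_perms_pos[of n] by (metis card.empty less_irrefl)
  have part: "(\<integral>\<^sup>+ \<pi>. e2ennreal (Y \<pi>) \<partial>measure_pmf (uniform_permutation n))
      = ennreal ((\<Sum>\<pi>\<in>?P. max 0 (s \<pi>)) / real (card ?P))"
    if "\<And>\<pi>. \<pi> permutes {1..n} \<Longrightarrow> Y \<pi> = ereal (s \<pi>)" for Y s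
  proof -
    have "(\<Sum>\<pi>\<in>?P. e2ennreal (Y \<pi>)) = (\<Sum>\<pi>\<in>?P. ennreal (max 0 (s \<pi>)))"
      by (intro sum.cong) (auto simp: that max_def ennreal_neg)
    also have "\<dots> = ennreal (\<Sum>\<pi>\<in>?P. max 0 (s \<pi>))"
      by (rule sum_ennreal) simp
    finally have "(\<Sum>\<pi>\<in>?P. e2ennreal (Y \<pi>)) = ennreal (\<Sum>\<pi>\<in>?P. max 0 (s \<pi>))" .
    then show ?thesis
      unfolding uniform_permutation_def
      using card_perms_pos[of n]
      by (subst nn_integral_pmf_of_set[OF ne finite_perms])
         (simp add: divide_ennreal sum_nonneg ennreal_of_nat_eq_real_of_nat)
  qed
  have "ereal_expectation (measure_pmf (uniform_permutation n)) X =
      ereal ((\<Sum>\<pi>\<in>?P. max 0 (r \<pi>)) / real (card ?P) - (\<Sum>\<pi>\<in>?P. max 0 (- r \<pi>)) / real (card ?P))"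
    unfolding ereal_expectation_def
    by (subst part[of X r], simp add: assms, subst part[of "\<lambda>\<pi>. - X \<pi>" "\<lambda>\<pi>. - r \<pi>"], simp add: assms)
       (simp add: enn2ereal_ennreal sum_nonneg)
  also have "(\<Sum>\<pi>\<in>?P. max 0 (r \<pi>)) / real (card ?P) - (\<Sum>\<pi>\<in>?P. max 0 (- r \<pi>)) / real (card ?P)
      = perm_avg n r"
    by (simp add: perm_avg_def flip: diff_divide_distrib sum_subtractf)
       (auto intro!: arg_cong[where f="\<lambda>s. s / _"] sum.cong)
  finally show ?thesis .
qed


text \<open>
  This is the case of a comparison point outside \<open>C\<close>, where the objective is infinite.
\<close>

lemma ereal_expectation_uniform_permutation_minf:
  assumes "\<And>\<pi>. \<pi> permutes {1..n} \<Longrightarrow> X \<pi> = - \<infinity>"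
  shows "ereal_expectation (measure_pmf (uniform_permutation n)) X = - \<infinity>"
proof -
  have "set_pmf (uniform_permutation n) = {\<pi>. \<pi> permutes {1..n}}"
    unfolding uniform_permutation_def using card_perms_pos[of n]
    by (intro set_pmf_of_set finite_perms) (metis card.empty less_irrefl)
  then have X: "AE \<pi> in measure_pmf (uniform_permutation n). X \<pi> = - \<infinity>"
    using assms by (auto simp: AE_measure_pmf_iff)
  have "(\<integral>\<^sup>+ \<pi>. e2ennreal (X \<pi>) \<partial>measure_pmf (uniform_permutation n))
      = (\<integral>\<^sup>+ \<pi>. 0 \<partial>measure_pmf (uniform_permutation n))"
    using X by (intro nn_integral_cong_AE) (auto elim!: eventually_mono simp: e2ennreal_neg)
  moreover have "(\<integral>\<^sup>+ \<pi>. e2ennreal (- X \<pi>) \<partial>measure_pmf (uniform_permutation n))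
      = (\<integral>\<^sup>+ \<pi>. top \<partial>measure_pmf (uniform_permutation n))"
    using X by (intro nn_integral_cong_AE) (auto elim!: eventually_mono)
  ultimately show ?thesis
    by (simp add: ereal_expectation_def zero_ennreal.rep_eq)
qed


section \<open>Runs of the subgradient method\<close>

locale component_subgradients =
  fixes C :: "'a::real_inner set" and n :: nat
    and f :: "nat \<Rightarrow> 'a \<Rightarrow> real" and g :: "nat \<Rightarrow> 'a \<Rightarrow> 'a" and G :: "nat \<Rightarrow> real"
  assumes n_pos: "n \<ge> 1"
    and subgradient: "\<And>i y u. i \<in> {1..n} \<Longrightarrow> y \<in> C \<Longrightarrow> u \<in> C \<Longrightarrow> f i u \<ge> f i y + inner (g i y) (u - y)"
    and subgradient_bound: "\<And>i y. i \<in> {1..n} \<Longrightarrow> y \<in> C \<Longrightarrow> norm (g i y) \<le> G i"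
    and G_pos: "\<And>i. i \<in> {1..n} \<Longrightarrow> G i > 0"
begin

definition F :: "'a \<Rightarrow> real" where
  "F y = (\<Sum>i=1..n. f i y) / real n"

definition run :: "(nat \<Rightarrow> nat) \<Rightarrow> real \<Rightarrow> nat \<Rightarrow> (nat \<Rightarrow> 'a) \<Rightarrow> bool" where
  "run ix h N x \<longleftrightarrow> x 1 \<in> C \<and>
     (\<forall>t\<in>{1..N}. is_projection C (x t - h *\<^sub>R g (ix t) (x t)) (x (t + 1)))"

abbreviation "G1 \<equiv> G_f1 n G"
abbreviation "G2 \<equiv> G_f2 n G"

lemma n_real_pos: "real n > 0"
  using n_pos by simp

lemma sum_G: "(\<Sum>i=1..n. G i) = real n * G1"
  using n_pos by (simp add: G_f1_def)

lemma sum_G_square: "(\<Sum>i=1..n. (G i)\<^sup>2) = real n * G2\<^sup>2"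
proof -
  have "(\<Sum>i=1..n. (G i)\<^sup>2) \<ge> 0"
    by (intro sum_nonneg) simp
  then show ?thesis
    using n_pos by (simp add: G_f2_def)
qed

lemma G1_pos: "G1 > 0"
proof -
  have "(\<Sum>i=1..n. G i) > 0"
    using n_pos G_pos by (intro sum_pos) auto
  then show ?thesis
    using n_pos by (simp add: G_f1_def)
qed

lemma G1_le_G2: "G1 \<le> G2"
proof -
  have "(real n * G1)\<^sup>2 \<le> (real n * G2\<^sup>2) * real n"
    using sum_squared_le_sum_of_squares[of G "{1..n}"] unfolding sum_G sum_G_square by simp
  then have "real n * real n * G1\<^sup>2 \<le> real n * real n * G2\<^sup>2"
    by (simp add: power_mult_distrib power2_eq_square mult_ac)
  then have "G1\<^sup>2 \<le> G2\<^sup>2"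
    using n_pos by simp
  moreover have "0 \<le> G2"
    by (simp add: G_f2_def sum_nonneg)
  ultimately show ?thesis
    by (rule power2_le_imp_le)
qed

lemma sum_G_square_le: "(\<Sum>i=1..n. (G i)\<^sup>2) \<le> (real n * G1)\<^sup>2"
proof -
  have "G i * G i \<le> G i * (real n * G1)" if "i \<in> {1..n}" for i
  proof (rule mult_left_mono)
    show "G i \<le> real n * G1"
      unfolding sum_G[symmetric] using that G_pos by (intro member_le_sum) (auto intro: less_imp_le)
  qed (use G_pos that in \<open>auto intro: less_imp_le\<close>)
  then have "(\<Sum>i=1..n. (G i)\<^sup>2) \<le> (\<Sum>i=1..n. G i * (real n * G1))"
    by (intro sum_mono) (simp add: power2_eq_square)
  also have "\<dots> = (real n * G1)\<^sup>2"
    unfolding sum_distrib_right[symmetric] sum_G by (simp add: power2_eq_square)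
  finally show ?thesis .
qed

lemma f_diff_le:
  assumes "i \<in> {1..n}" "y \<in> C" "u \<in> C"
  shows "f i y - f i u \<le> G i * norm (y - u)"
proof -
  have "f i y - f i u \<le> inner (g i y) (y - u)"
    using subgradient[OF assms] by (simp add: inner_diff_right)
  also have "\<dots> \<le> norm (g i y) * norm (y - u)"
    by (rule norm_cauchy_schwarz)
  also have "\<dots> \<le> G i * norm (y - u)"
    using subgradient_bound[OF assms(1,2)] by (intro mult_right_mono) auto
  finally show ?thesis .
qed

lemma F_diff_le:
  assumes "y \<in> C" "u \<in> C"
  shows "F y - F u \<le> G1 * norm (y - u)"
proof -
  have "(\<Sum>i=1..n. f i y - f i u) \<le> (\<Sum>i=1..n. G i * norm (y - u))"
    using assms by (intro sum_mono f_diff_le)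
  then have "(\<Sum>i=1..n. f i y - f i u) \<le> real n * G1 * norm (y - u)"
    unfolding sum_distrib_right[symmetric] sum_G .
  then show ?thesis
    using n_pos by (simp add: F_def sum_subtractf field_simps)
qed

lemma run_in_C:
  assumes "run ix h N x" "t \<in> {1..N+1}"
  shows "x t \<in> C"
proof (cases "t = 1")
  case False
  then have "t - 1 \<in> {1..N}" "t - 1 + 1 = t" using assms(2) by auto
  then show ?thesis
    using assms(1) unfolding run_def is_projection_def by metis
qed (use assms in \<open>auto simp: run_def\<close>)

lemma run_movement:
  assumes "run ix h N x" "h > 0" "\<And>t. t \<ge> 1 \<Longrightarrow> ix t \<in> {1..n}" "s \<ge> 1" "s + m \<le> N + 1"
  shows "norm (x (s + m) - x s) \<le> h * (\<Sum>t=s..<s+m. G (ix t))"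
  using assms(5)
proof (induction m)
  case (Suc m)
  let ?t = "s + m"
  have t: "?t \<in> {1..N}" "?t \<in> {1..N+1}"
    using Suc.prems assms(4) by auto
  have xC: "x ?t \<in> C"
    by (rule run_in_C[OF assms(1) t(2)])
  have "is_projection C (x ?t - h *\<^sub>R g (ix ?t) (x ?t)) (x (?t + 1))"
    using assms(1) t(1) by (auto simp: run_def)
  from is_projection_nonexpansive[OF this is_projection_self[OF xC]]
  have "norm (x (?t + 1) - x ?t) \<le> h * norm (g (ix ?t) (x ?t))"
    using assms(2) by simp
  also have "\<dots> \<le> h * G (ix ?t)"
    using assms(2,3,4) xC by (intro mult_left_mono subgradient_bound) auto
  finally have "norm (x (?t + 1) - x ?t) \<le> h * G (ix ?t)" .
  moreover have "norm (x (?t + 1) - x s) \<le> norm (x (?t + 1) - x ?t) + norm (x ?t - x s)"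
    using norm_triangle_ineq[of "x (?t + 1) - x ?t" "x ?t - x s"] by simp
  ultimately show ?case
    using Suc by (simp add: algebra_simps)
qed simp

text \<open>
  The regret inequality of the subgradient method against a point \<open>u\<close>: projection does not increase
  the distance to \<open>u\<close>, and expanding the square of an unprojected step leaves the linear term, which
  the subgradient inequality turns into function values.
\<close>

lemma run_descent:
  assumes "run ix h N x" "h > 0" "\<And>t. t \<ge> 1 \<Longrightarrow> ix t \<in> {1..n}" "s \<ge> 1" "s + m \<le> N + 1" "u \<in> C"
  shows "2 * h * (\<Sum>t=s..<s+m. f (ix t) (x t) - f (ix t) u)
    \<le> (norm (x s - u))\<^sup>2 - (norm (x (s + m) - u))\<^sup>2 + h\<^sup>2 * (\<Sum>t=s..<s+m. (G (ix t))\<^sup>2)"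
  using assms(5)
proof (induction m)
  case (Suc m)
  let ?t = "s + m"
  let ?g = "g (ix ?t) (x ?t)"
  have t: "?t \<in> {1..N}" "?t \<in> {1..N+1}" "ix ?t \<in> {1..n}"
    using Suc.prems assms(3,4) by auto
  have xC: "x ?t \<in> C"
    by (rule run_in_C[OF assms(1) t(2)])
  have "is_projection C (x ?t - h *\<^sub>R ?g) (x (?t + 1))"
    using assms(1) t(1) by (auto simp: run_def)
  from is_projection_nonexpansive[OF this is_projection_self[OF assms(6)]]
  have "(norm (x (?t + 1) - u))\<^sup>2 \<le> (norm (x ?t - h *\<^sub>R ?g - u))\<^sup>2"
    by simp
  also have "\<dots> = (norm (x ?t - u))\<^sup>2 + 2 * h * inner ?g (u - x ?t) + h\<^sup>2 * (norm ?g)\<^sup>2"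
    unfolding power2_norm_eq_inner by (simp add: algebra_simps inner_commute power2_eq_square)
  also have "\<dots> \<le> (norm (x ?t - u))\<^sup>2 + 2 * h * (f (ix ?t) u - f (ix ?t) (x ?t)) + h\<^sup>2 * (G (ix ?t))\<^sup>2"
    using assms(2) subgradient[OF t(3) xC assms(6)] subgradient_bound[OF t(3) xC]
    by (intro add_mono mult_left_mono power_mono) auto
  finally have "2 * h * (f (ix ?t) (x ?t) - f (ix ?t) u)
      \<le> (norm (x ?t - u))\<^sup>2 - (norm (x (?t + 1) - u))\<^sup>2 + h\<^sup>2 * (G (ix ?t))\<^sup>2"
    by (simp add: algebra_simps)
  then show ?case
    using Suc by (simp add: distrib_left)
qed simp


section \<open>The bound that holds for every order\<close>

lemma single_shuffle_range:
  assumes "\<pi> permutes {1..n}" "t \<ge> 1"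
  shows "single_shuffle n \<pi> t \<in> {1..n}"
  using cyclic_index_range[OF n_pos assms(2)] permutes_in_image[OF assms(1)]
  by (simp add: single_shuffle_def)

lemma sum_one_pass_single_shuffle:
  assumes "\<pi> permutes {1..n}"
  shows "(\<Sum>t=k*n+1..<k*n+1+n. \<phi> (single_shuffle n \<pi> t)) = (\<Sum>i=1..n. \<phi> i)"
  using sum_one_pass[of "\<lambda>j. \<phi> (\<pi> j)" n k] sum.permute[OF assms, of \<phi>]
  by (simp add: single_shuffle_def comp_def)

text \<open>
  Within a pass, the iterate is within \<open>h n G1\<close> of the start of the pass, so moving each component
  to the start costs \<open>h (n G1)\<^sup>2\<close> in total and turns the sum of the components into \<open>n F\<close>. With the
  factor \<open>2 h\<close> this contributes two of the three error units; the squared subgradients contribute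
  the third.
\<close>

lemma pass_descent:
  assumes "\<pi> permutes {1..n}" "run (single_shuffle n \<pi>) h (K * n) x" "h > 0" "k < K" "u \<in> C"
  shows "2 * h * real n * (F (x (k*n+1)) - F u)
    \<le> (norm (x (k*n+1) - u))\<^sup>2 - (norm (x (Suc k*n+1) - u))\<^sup>2 + 3 * h\<^sup>2 * (real n * G1)\<^sup>2"
proof -
  let ?ix = "single_shuffle n \<pi>" and ?s = "k*n+1"
  have "Suc k * n \<le> K * n"
    using assms(4) by (intro mult_le_mono1) simp
  then have end_pass: "?s + n \<le> K * n + 1"
    by simp
  have range: "?ix t \<in> {1..n}" if "t \<ge> 1" for t
    by (rule single_shuffle_range[OF assms(1) that])
  have s_C: "x ?s \<in> C"
    using assms(4) by (intro run_in_C[OF assms(2)]) auto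
  have "f (?ix t) (x ?s) - G (?ix t) * (h * (real n * G1)) \<le> f (?ix t) (x t)"
    if t: "t \<in> {?s..<?s+n}" for t
  proof -
    have "norm (x (?s + (t - ?s)) - x ?s) \<le> h * (\<Sum>r=?s..<?s+(t-?s). G (?ix r))"
      using t end_pass by (intro run_movement[OF assms(2,3) range]) auto
    also have "\<dots> \<le> h * (\<Sum>r=?s..<?s+n. G (?ix r))"
      using t assms(3) G_pos range
      by (intro mult_left_mono sum_mono2) (auto intro!: less_imp_le)
    also have "\<dots> = h * (real n * G1)"
      unfolding sum_one_pass_single_shuffle[OF assms(1)] sum_G ..
    finally have "norm (x ?s - x t) \<le> h * (real n * G1)"
      using t by (simp add: norm_minus_commute)
    moreover have "f (?ix t) (x ?s) - f (?ix t) (x t) \<le> G (?ix t) * norm (x ?s - x t)"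
      using t end_pass range by (intro f_diff_le s_C run_in_C[OF assms(2)]) auto
    moreover have "G (?ix t) > 0"
      using t range by (intro G_pos) auto
    ultimately show ?thesis
      using mult_left_mono[of "norm (x ?s - x t)" "h * (real n * G1)" "G (?ix t)"] by linarith
  qed
  then have "(\<Sum>t=?s..<?s+n. f (?ix t) (x ?s) - G (?ix t) * (h * (real n * G1)) - f (?ix t) u)
      \<le> (\<Sum>t=?s..<?s+n. f (?ix t) (x t) - f (?ix t) u)"
    by (intro sum_mono diff_right_mono)
  moreover have "(\<Sum>t=?s..<?s+n. f (?ix t) (x ?s) - G (?ix t) * (h * (real n * G1)) - f (?ix t) u)
      = real n * (F (x ?s) - F u) - h * (real n * G1)\<^sup>2"
    unfolding sum_one_pass_single_shuffle[OF assms(1), of "\<lambda>i. f i (x ?s) - G i * (h * (real n * G1)) - f i u"]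
    unfolding sum_subtractf sum_distrib_right[symmetric] sum_G
    using n_pos by (simp add: F_def power2_eq_square right_diff_distrib)
  ultimately have "2 * h * (real n * (F (x ?s) - F u) - h * (real n * G1)\<^sup>2)
      \<le> 2 * h * (\<Sum>t=?s..<?s+n. f (?ix t) (x t) - f (?ix t) u)"
    using assms(3) by (intro mult_left_mono) auto
  also have "\<dots> \<le> (norm (x ?s - u))\<^sup>2 - (norm (x (?s + n) - u))\<^sup>2
      + h\<^sup>2 * (\<Sum>t=?s..<?s+n. (G (?ix t))\<^sup>2)"
    using end_pass assms(5) by (intro run_descent[OF assms(2,3) range]) auto
  also have "(\<Sum>t=?s..<?s+n. (G (?ix t))\<^sup>2) = (\<Sum>i=1..n. (G i)\<^sup>2)"
    by (rule sum_one_pass_single_shuffle[OF assms(1)])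
  also have "h\<^sup>2 * (\<Sum>i=1..n. (G i)\<^sup>2) \<le> h\<^sup>2 * (real n * G1)\<^sup>2"
    using sum_G_square_le by (intro mult_left_mono) auto
  finally show ?thesis
    by (simp add: algebra_simps power2_eq_square)
qed

lemma any_order_last_iterate:
  assumes "\<pi> permutes {1..n}" "run (single_shuffle n \<pi>) h (K * n) x" "h > 0" "K \<ge> 1" "z \<in> C"
  shows "F (x (K * n + 1)) - F z
    \<le> (norm (x 1 - z))\<^sup>2 / (2 * h * real (n * K)) + 4 * h * real n * G1\<^sup>2 * (1 + ln (real K))"
proof -
  define y where "y k = x ((k - 1) * n + 1)" for k
  define E where "E = 3 / 2 * h * real n * G1\<^sup>2"
  have range: "single_shuffle n \<pi> t \<in> {1..n}" if "t \<ge> 1" for t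
    by (rule single_shuffle_range[OF assms(1) that])
  have y_C: "y k \<in> C" if "k \<in> {1..K+1}" for k
    unfolding y_def using that by (intro run_in_C[OF assms(2)]) auto
  have hn: "2 * h * real n > 0"
    using assms(3) n_pos by simp
  have step: "2 * h * real n * (F (y k) - F u)
      \<le> (norm (y k - u))\<^sup>2 - (norm (y (Suc k) - u))\<^sup>2 + 2 * h * real n * E"
    if "k \<in> {1..K}" "u \<in> C" for k u
  proof -
    have "k - 1 < K" "Suc (k - 1) = k"
      using that by auto
    with pass_descent[OF assms(1-3), of "k - 1" u] that(2) show ?thesis
      by (simp add: y_def E_def power2_eq_square mult_ac)
  qed
  have tail: "(\<Sum>k=s..K. F (y k) - F u) \<le> (norm (y s - u))\<^sup>2 / (2 * h * real n) + real (K - s + 1) * E"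
    if "s \<in> {1..K}" "u \<in> C" for s u
  proof -
    have "2 * h * real n * (\<Sum>k=s..K. F (y k) - F u)
        = (\<Sum>k=s..K. 2 * h * real n * (F (y k) - F u))"
      by (rule sum_distrib_left)
    also have "\<dots> \<le> (\<Sum>k=s..K. ((norm (y k - u))\<^sup>2 - (norm (y (Suc k) - u))\<^sup>2) + 2 * h * real n * E)"
      using that by (intro sum_mono step) auto
    also have "\<dots> = (norm (y s - u))\<^sup>2 - (norm (y (Suc K) - u))\<^sup>2 + real (K - s + 1) * (2 * h * real n * E)"
      using that sum_Suc_diff[of s K "\<lambda>k. - (norm (y k - u))\<^sup>2"]
      by (simp add: sum.distrib Suc_diff_le)
    also have "\<dots> \<le> (norm (y s - u))\<^sup>2 + real (K - s + 1) * (2 * h * real n * E)"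
      by simp
    finally have "2 * h * real n * (\<Sum>k=s..K. F (y k) - F u)
        \<le> 2 * h * real n * ((norm (y s - u))\<^sup>2 / (2 * h * real n) + real (K - s + 1) * E)"
      using assms(3) n_pos by (simp add: distrib_left mult_ac)
    then show ?thesis
      using hn by (simp only: mult_le_cancel_left_pos)
  qed
  have "F (y K) - F z \<le> ((norm (x 1 - z))\<^sup>2 / (2 * h * real n)) / real K + 2 * E * (1 + ln (real K))"
  proof (rule last_iterate_bound)
    show "E \<ge> 0"
      using assms(3) by (simp add: E_def)
    show "(\<Sum>t=s..K. F (y t) - F (y s)) \<le> real (K - s + 1) * E" if "s \<in> {1..K}" for s
      using tail[OF that, of "y s"] y_C that by simp
    show "(\<Sum>t=1..K. F (y t) - F z) \<le> (norm (x 1 - z))\<^sup>2 / (2 * h * real n) + real K * E"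
      using tail[of 1 z] assms(4,5) by (simp add: y_def)
  qed fact
  moreover have "F (x (K * n + 1)) - F (y K) \<le> h * real n * G1\<^sup>2"
  proof -
    have s: "(K - 1) * n + 1 + n = K * n + 1"
      using assms(4) by (cases K) auto
    have "norm (x (K * n + 1) - y K) \<le> h * (real n * G1)"
      using run_movement[OF assms(2,3) range, of "(K - 1) * n + 1" n]
      unfolding sum_one_pass_single_shuffle[OF assms(1)] sum_G unfolding s y_def by simp
    then have "G1 * norm (x (K * n + 1) - y K) \<le> G1 * (h * (real n * G1))"
      using G1_pos by (intro mult_left_mono) auto
    moreover have "F (x (K * n + 1)) - F (y K) \<le> G1 * norm (x (K * n + 1) - y K)"
      using assms(4) by (intro F_diff_le y_C run_in_C[OF assms(2)]) auto
    ultimately show ?thesis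
      by (simp add: power2_eq_square mult_ac)
  qed
  moreover have "h * real n * G1\<^sup>2 \<le> h * real n * G1\<^sup>2 * (1 + ln (real K))"
    using assms(3,4) mult_left_mono[of 1 "1 + ln (real K)" "h * real n * G1\<^sup>2"] by simp
  moreover have "2 * E * (1 + ln (real K)) = 3 * (h * real n * G1\<^sup>2 * (1 + ln (real K)))"
    by (simp add: E_def)
  ultimately show ?thesis
    by (simp add: mult_ac)
qed


section \<open>The bound on average over the order\<close>

text \<open>
  For a nonsmooth convex function a subgradient step need not be nonexpansive, but monotonicity
  removes the cross term, so that only a second-order growth of the squared distance remains.
\<close>

lemma step_stability_same_index:
  assumes "i \<in> {1..n}" "h > 0" "y \<in> C" "w \<in> C"
    and "is_projection C (y - h *\<^sub>R g i y) y'" "is_projection C (w - h *\<^sub>R g i w) w'"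
  shows "(norm (y' - w'))\<^sup>2 \<le> (norm (y - w))\<^sup>2 + (2 * h * G i)\<^sup>2"
proof -
  let ?e = "g i y - g i w"
  have "f i w \<ge> f i y + inner (g i y) (w - y)" "f i y \<ge> f i w + inner (g i w) (y - w)"
    using assms by (auto intro: subgradient)
  then have monotone: "inner ?e (y - w) \<ge> 0"
    by (simp add: algebra_simps)
  have "norm ?e \<le> norm (g i y) + norm (g i w)"
    by (rule norm_triangle_ineq4)
  also have "\<dots> \<le> G i + G i"
    using assms by (intro add_mono subgradient_bound)
  finally have e: "norm ?e \<le> 2 * G i"
    by simp
  have "(norm (y' - w'))\<^sup>2 \<le> (norm (y - h *\<^sub>R g i y - (w - h *\<^sub>R g i w)))\<^sup>2"
    by (intro power_mono is_projection_nonexpansive[OF assms(5,6)]) simp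
  also have "\<dots> = (norm ((y - w) - h *\<^sub>R ?e))\<^sup>2"
    by (simp add: algebra_simps)
  also have "\<dots> = (norm (y - w))\<^sup>2 - 2 * h * inner ?e (y - w) + (h * norm ?e)\<^sup>2"
    unfolding power_mult_distrib power2_norm_eq_inner
    by (simp add: inner_diff inner_commute power2_eq_square)
  also have "\<dots> \<le> (norm (y - w))\<^sup>2 + (h * norm ?e)\<^sup>2"
    using monotone assms(2) by simp
  also have "(h * norm ?e)\<^sup>2 \<le> (h * (2 * G i))\<^sup>2"
    using e assms(2) by (intro power_mono mult_left_mono) auto
  finally show ?thesis
    by (simp add: mult_ac)
qed

lemma step_stability_different_index:
  assumes "i \<in> {1..n}" "j \<in> {1..n}" "h > 0" "y \<in> C" "w \<in> C"
    and "is_projection C (y - h *\<^sub>R g i y) y'" "is_projection C (w - h *\<^sub>R g j w) w'"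
  shows "norm (y' - w') \<le> norm (y - w) + h * (G i + G j)"
proof -
  have "norm (y' - w') \<le> norm (y - h *\<^sub>R g i y - (w - h *\<^sub>R g j w))"
    by (rule is_projection_nonexpansive[OF assms(6,7)])
  also have "\<dots> = norm ((y - w) - h *\<^sub>R (g i y - g j w))"
    by (simp add: algebra_simps)
  also have "\<dots> \<le> norm (y - w) + norm (h *\<^sub>R (g i y - g j w))"
    by (rule norm_triangle_ineq4)
  also have "norm (h *\<^sub>R (g i y - g j w)) \<le> h * (norm (g i y) + norm (g j w))"
    using assms(3) by (simp add: norm_triangle_ineq4)
  also have "\<dots> \<le> h * (G i + G j)"
    using assms by (intro mult_left_mono add_mono subgradient_bound) auto
  finally show ?thesis by simp
qed

text \<open>
  The distance of the two runs is bounded by \<open>sqrt A + B\<close>, where \<open>A\<close> collects the growth of the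
  squared distance in the steps with equal components and \<open>B\<close> the growth of the distance itself in
  the steps with exchanged components. This shape is preserved by both kinds of step, because
  \<open>(sqrt A + B)\<^sup>2 + c \<le> (sqrt (A + c) + B)\<^sup>2\<close>.
\<close>

lemma swap_stability:
  assumes "\<pi> permutes {1..n}" "p \<in> {1..n}" "q \<in> {1..n}" "h > 0"
    and x: "run (single_shuffle n \<pi>) h (K * n) x"
    and x': "run (single_shuffle n (\<pi> \<circ> Transposition.transpose p q)) h (K * n) x'"
    and "x 1 = x' 1" "t \<in> {1..K*n+1}"
  shows "norm (x t - x' t) \<le> 2 * h * sqrt (real (n * K)) * G2 + 2 * real K * h * (G (\<pi> p) + G (\<pi> q))"
proof -
  let ?\<pi>' = "\<pi> \<circ> Transposition.transpose p q"
  let ?b = "h * (G (\<pi> p) + G (\<pi> q))"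
  define \<alpha> where "\<alpha> j = (2 * h * G (\<pi> j))\<^sup>2" for j
  define \<beta> where "\<beta> j = (if j \<in> {p, q} then ?b else 0)" for j
  define A where "A m = (\<Sum>u=1..<m. \<alpha> (cyclic_index n u))" for m
  define B where "B m = (\<Sum>u=1..<m. \<beta> (cyclic_index n u))" for m
  have pq_range: "\<pi> p \<in> {1..n}" "\<pi> q \<in> {1..n}"
    using assms(2,3) permutes_in_image[OF assms(1)] by auto
  have b: "?b \<ge> 0"
    using assms(4) G_pos[OF pq_range(1)] G_pos[OF pq_range(2)] by simp
  have \<alpha>_nonneg: "\<alpha> j \<ge> 0" and \<beta>_nonneg: "\<beta> j \<ge> 0" for j
    using b by (auto simp: \<alpha>_def \<beta>_def)
  have A_nonneg: "A m \<ge> 0" and B_nonneg: "B m \<ge> 0" for m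
    by (auto simp: A_def B_def intro!: sum_nonneg \<alpha>_nonneg \<beta>_nonneg)
  have "norm (x m - x' m) \<le> sqrt (A m) + B m" if "1 \<le> m" "m \<le> K * n + 1" for m
    using that
  proof (induction m rule: dec_induct)
    case base
    then show ?case using assms(7) by (simp add: A_def B_def)
  next
    case (step m)
    let ?j = "cyclic_index n m" and ?\<delta> = "norm (x m - x' m)"
    have m: "m \<in> {1..K*n}" "m \<in> {1..K*n+1}"
      using step by auto
    have IH: "?\<delta> \<le> sqrt (A m) + B m"
      using step by simp
    have Suc: "A (Suc m) = A m + \<alpha> ?j" "B (Suc m) = B m + \<beta> ?j"
      using m by (auto simp: A_def B_def)
    have j: "\<pi> ?j \<in> {1..n}"
      using cyclic_index_range[OF n_pos, of m] m permutes_in_image[OF assms(1)] by auto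
    have C: "x m \<in> C" "x' m \<in> C"
      using m(2) by (auto intro: run_in_C[OF x] run_in_C[OF x'])
    have proj: "is_projection C (x m - h *\<^sub>R g (\<pi> ?j) (x m)) (x (Suc m))"
      "is_projection C (x' m - h *\<^sub>R g (?\<pi>' ?j) (x' m)) (x' (Suc m))"
      using x x' m(1) by (auto simp: run_def single_shuffle_def)
    show ?case
    proof (cases "?j \<in> {p, q}")
      case True
      then have "\<pi> ?j = \<pi> p \<and> ?\<pi>' ?j = \<pi> q \<or> \<pi> ?j = \<pi> q \<and> ?\<pi>' ?j = \<pi> p"
        by auto
      then have "norm (x (Suc m) - x' (Suc m)) \<le> ?\<delta> + ?b"
        using step_stability_different_index[OF _ _ assms(4) C proj] pq_range
        by (auto simp: add.commute)
      moreover have "sqrt (A m) \<le> sqrt (A (Suc m))"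
        using \<alpha>_nonneg by (simp add: Suc)
      moreover have "B (Suc m) = B m + ?b"
        using True by (simp add: Suc \<beta>_def)
      ultimately show ?thesis
        using IH by linarith
    next
      case False
      then have "?\<pi>' ?j = \<pi> ?j"
        by (simp add: transpose_def)
      then have "(norm (x (Suc m) - x' (Suc m)))\<^sup>2 \<le> ?\<delta>\<^sup>2 + \<alpha> ?j"
        using step_stability_same_index[OF j assms(4) C proj(1)] proj(2) by (simp add: \<alpha>_def)
      also have "?\<delta>\<^sup>2 \<le> (sqrt (A m) + B m)\<^sup>2"
        by (intro power_mono IH) simp
      also have "(sqrt (A m) + B m)\<^sup>2 + \<alpha> ?j = A (Suc m) + 2 * B m * sqrt (A m) + (B m)\<^sup>2"
        using A_nonneg by (simp add: Suc power2_sum)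
      also have "\<dots> \<le> A (Suc m) + 2 * B m * sqrt (A (Suc m)) + (B m)\<^sup>2"
        using B_nonneg \<alpha>_nonneg by (intro add_mono mult_left_mono) (auto simp: Suc)
      also have "\<dots> = (sqrt (A (Suc m)) + B m)\<^sup>2"
        using A_nonneg by (simp add: power2_sum)
      finally have "(norm (x (Suc m) - x' (Suc m)))\<^sup>2 \<le> (sqrt (A (Suc m)) + B m)\<^sup>2"
        by simp
      from power2_le_imp_le[OF this] have "norm (x (Suc m) - x' (Suc m)) \<le> sqrt (A (Suc m)) + B m"
        using A_nonneg[of "Suc m"] B_nonneg[of m] by simp
      then show ?thesis
        using False by (simp add: Suc \<beta>_def)
    qed
  qed
  then have "norm (x t - x' t) \<le> sqrt (A t) + B t"
    using assms(8) by simp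
  also have "A t \<le> A (K*n+1)"
    unfolding A_def using assms(8) by (intro sum_mono2) (auto intro: \<alpha>_nonneg)
  also have "B t \<le> B (K*n+1)"
    unfolding B_def using assms(8) by (intro sum_mono2) (auto intro: \<beta>_nonneg)
  also have "A (K*n+1) = real (n * K) * (2 * h * G2)\<^sup>2"
  proof -
    have "(\<Sum>j=1..n. \<alpha> j) = (2 * h)\<^sup>2 * (\<Sum>j=1..n. (G (\<pi> j))\<^sup>2)"
      by (simp add: \<alpha>_def power_mult_distrib sum_distrib_left)
    also have "(\<Sum>j=1..n. (G (\<pi> j))\<^sup>2) = real n * G2\<^sup>2"
      using sum.permute[OF assms(1), of "\<lambda>i. (G i)\<^sup>2"] sum_G_square by (simp add: comp_def)
    finally show ?thesis
      unfolding A_def sum_cyclic_passes by (simp add: power_mult_distrib)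
  qed
  also have "sqrt (real (n * K) * (2 * h * G2)\<^sup>2) = 2 * h * sqrt (real (n * K)) * G2"
    using assms(4) G1_pos G1_le_G2 by (simp add: real_sqrt_mult)
  also have "B (K*n+1) \<le> 2 * real K * h * (G (\<pi> p) + G (\<pi> q))"
  proof -
    have "(\<Sum>j=1..n. \<beta> j) = (\<Sum>j\<in>{p, q}. ?b)"
      unfolding \<beta>_def using assms(2,3) by (intro sum.mono_neutral_cong_right) auto
    also have "\<dots> = real (card {p, q}) * ?b"
      by simp
    also have "\<dots> \<le> 2 * ?b"
      using b by (intro mult_right_mono) (auto simp: card_insert_if)
    finally have "real K * (\<Sum>j=1..n. \<beta> j) \<le> real K * (2 * ?b)"
      by (intro mult_left_mono) auto
    then show ?thesis
      unfolding B_def sum_cyclic_passes by (simp add: mult_ac)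
  qed
  finally show ?thesis by simp
qed

end

locale shuffled_runs = component_subgradients C n f g G
  for C :: "'a::real_inner set" and n f g G +
  fixes h :: real and K :: nat and x1 :: 'a and x :: "(nat \<Rightarrow> nat) \<Rightarrow> nat \<Rightarrow> 'a"
  assumes h_pos: "h > 0" and K_pos: "K \<ge> 1"
    and runs: "\<And>\<pi>. \<pi> permutes {1..n} \<Longrightarrow> run (single_shuffle n \<pi>) h (K * n) (x \<pi>)"
    and start: "\<And>\<pi>. \<pi> permutes {1..n} \<Longrightarrow> x \<pi> 1 = x1"
begin

definition stability_error :: real where
  "stability_error = 2 * h * sqrt (real (n * K)) * G1 * G2 + 2 * real K * h * (G2\<^sup>2 + G1\<^sup>2)"

lemma stability_error_nonneg: "stability_error \<ge> 0"
  using h_pos G1_pos G1_le_G2 by (simp add: stability_error_def)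

text \<open>
  Writing \<open>F\<close> as the mean over the positions \<open>q\<close> and exchanging \<open>p\<close> and \<open>q\<close> in the \<open>q\<close>-th term shows
  \<open>f (\<pi> p)\<close> everywhere, evaluated at the iterates of \<open>\<pi>\<close> and of the exchanged permutations.
\<close>

lemma component_vs_mean:
  assumes p: "p \<in> {1..n}" and t: "t \<in> {1..K*n+1}"
  shows "\<bar>perm_avg n (\<lambda>\<pi>. f (\<pi> p) (x \<pi> t) - F (x \<pi> t))\<bar> \<le> stability_error"
proof -
  define \<tau> where "\<tau> q = Transposition.transpose p q" for q
  define S where "S = 2 * h * sqrt (real (n * K)) * G2"
  define gap where "gap q \<pi> = f (\<pi> p) (x \<pi> t) - f (\<pi> p) (x (\<pi> \<circ> \<tau> q) t)" for q \<pi>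
  define bound where "bound q \<pi> = G (\<pi> p) * (S + 2 * real K * h * (G (\<pi> p) + G (\<pi> q)))" for q \<pi>
  have "real n * perm_avg n (\<lambda>\<pi>. F (x \<pi> t)) = perm_avg n (\<lambda>\<pi>. \<Sum>q=1..n. f (\<pi> q) (x \<pi> t))"
    unfolding perm_avg_cmult[symmetric]
  proof (rule perm_avg_cong)
    fix \<pi> assume "\<pi> permutes {1..n}"
    from sum.permute[OF this, of "\<lambda>i. f i (x \<pi> t)"]
    show "real n * F (x \<pi> t) = (\<Sum>q=1..n. f (\<pi> q) (x \<pi> t))"
      using n_pos by (simp add: F_def comp_def)
  qed
  also have "\<dots> = (\<Sum>q=1..n. perm_avg n (\<lambda>\<pi>. f (\<pi> q) (x \<pi> t)))"
    by (rule perm_avg_sum)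
  also have "\<dots> = (\<Sum>q=1..n. perm_avg n (\<lambda>\<pi>. f (\<pi> p) (x (\<pi> \<circ> \<tau> q) t)))"
  proof (rule sum.cong[OF refl])
    fix q assume q: "q \<in> {1..n}"
    from perm_avg_swap[OF p q, of "\<lambda>\<pi>. f (\<pi> q) (x \<pi> t)"]
    show "perm_avg n (\<lambda>\<pi>. f (\<pi> q) (x \<pi> t)) = perm_avg n (\<lambda>\<pi>. f (\<pi> p) (x (\<pi> \<circ> \<tau> q) t))"
      by (simp add: \<tau>_def)
  qed
  finally have mean: "real n * perm_avg n (\<lambda>\<pi>. f (\<pi> p) (x \<pi> t) - F (x \<pi> t))
      = (\<Sum>q=1..n. perm_avg n (gap q))"
    by (simp add: gap_def[abs_def] perm_avg_diff right_diff_distrib sum_subtractf)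
  have gap_le: "\<bar>gap q \<pi>\<bar> \<le> bound q \<pi>" if q: "q \<in> {1..n}" and \<pi>: "\<pi> permutes {1..n}" for q \<pi>
  proof -
    have \<pi>': "\<pi> \<circ> \<tau> q permutes {1..n}"
      unfolding \<tau>_def by (rule permutes_compose[OF permutes_swap_id[OF p q] \<pi>])
    have C: "x \<pi> t \<in> C" "x (\<pi> \<circ> \<tau> q) t \<in> C"
      using t by (auto intro: run_in_C[OF runs[OF \<pi>]] run_in_C[OF runs[OF \<pi>']])
    have i: "\<pi> p \<in> {1..n}"
      using p permutes_in_image[OF \<pi>] by simp
    have "norm (x \<pi> t - x (\<pi> \<circ> \<tau> q) t) \<le> S + 2 * real K * h * (G (\<pi> p) + G (\<pi> q))"
      unfolding S_def
      using swap_stability[OF \<pi> p q h_pos runs[OF \<pi>] runs[OF \<pi>'[unfolded \<tau>_def]] _ t]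
        start[OF \<pi>] start[OF \<pi>'] by (simp add: \<tau>_def)
    then have "G (\<pi> p) * norm (x \<pi> t - x (\<pi> \<circ> \<tau> q) t) \<le> bound q \<pi>"
      unfolding bound_def using G_pos[OF i] by (intro mult_left_mono) auto
    then show ?thesis
      using f_diff_le[OF i C] f_diff_le[OF i C(2,1)] by (simp add: gap_def norm_minus_commute)
  qed
  have "\<bar>perm_avg n (gap q)\<bar> \<le> perm_avg n (bound q)" if "q \<in> {1..n}" for q
  proof -
    have "perm_avg n (gap q) \<le> perm_avg n (bound q)"
      using gap_le[OF that] by (intro perm_avg_mono) (auto simp: abs_le_iff)
    moreover have "perm_avg n (\<lambda>\<pi>. (-1) * gap q \<pi>) \<le> perm_avg n (bound q)"
      using gap_le[OF that] by (intro perm_avg_mono) (auto simp: abs_le_iff)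
    ultimately show ?thesis
      unfolding perm_avg_cmult by simp
  qed
  then have "(\<Sum>q=1..n. \<bar>perm_avg n (gap q)\<bar>) \<le> (\<Sum>q=1..n. perm_avg n (bound q))"
    by (intro sum_mono)
  then have "\<bar>\<Sum>q=1..n. perm_avg n (gap q)\<bar> \<le> (\<Sum>q=1..n. perm_avg n (bound q))"
    by (rule order_trans[OF sum_abs])
  also have "\<dots> = perm_avg n (\<lambda>\<pi>. \<Sum>q=1..n. bound q \<pi>)"
    by (rule perm_avg_sum[symmetric])
  also have "\<dots> = perm_avg n (\<lambda>\<pi>. real n * ((S + 2 * real K * h * G1) * G (\<pi> p) + 2 * real K * h * (G (\<pi> p))\<^sup>2))"
  proof (rule perm_avg_cong)
    fix \<pi> assume \<pi>: "\<pi> permutes {1..n}"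
    have "(\<Sum>q=1..n. G (\<pi> q)) = real n * G1"
      using sum.permute[OF \<pi>, of G] sum_G by (simp add: comp_def)
    moreover have "(\<Sum>q=1..n. bound q \<pi>) = G (\<pi> p) * (real n * S + 2 * real K * h * (real n * G (\<pi> p) + (\<Sum>q=1..n. G (\<pi> q))))"
      by (simp add: bound_def sum_distrib_left[symmetric] sum.distrib)
    ultimately show "(\<Sum>q=1..n. bound q \<pi>)
        = real n * ((S + 2 * real K * h * G1) * G (\<pi> p) + 2 * real K * h * (G (\<pi> p))\<^sup>2)"
      by (simp add: algebra_simps power2_eq_square)
  qed
  also have "\<dots> = real n * ((S + 2 * real K * h * G1) * G1 + 2 * real K * h * G2\<^sup>2)"
    unfolding perm_avg_cmult perm_avg_add
      perm_avg_component[OF p, of G] perm_avg_component[OF p, of "\<lambda>i. (G i)\<^sup>2"] sum_G sum_G_square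
    using n_pos by simp
  also have "\<dots> = real n * stability_error"
    by (simp add: S_def stability_error_def algebra_simps power2_eq_square)
  finally have "real n * \<bar>perm_avg n (\<lambda>\<pi>. f (\<pi> p) (x \<pi> t) - F (x \<pi> t))\<bar> \<le> real n * stability_error"
    unfolding mean[symmetric] abs_mult by simp
  then show ?thesis
    using n_pos by simp
qed

text \<open>
  The reference point may depend on the permutation, which is what allows earlier iterates of the
  same run. The hypothesis on \<open>u\<close> replaces the components by their mean at the reference point, and
  \<open>component_vs_mean\<close> does so at the iterates, hence the factor 2.
\<close>

lemma average_descent:
  assumes s: "s \<in> {1..K*n}" and u: "\<And>\<pi>. \<pi> permutes {1..n} \<Longrightarrow> u \<pi> \<in> C"
    and unbiased: "\<And>p. p \<in> {1..n} \<Longrightarrow> perm_avg n (\<lambda>\<pi>. f (\<pi> p) (u \<pi>) - F (u \<pi>)) \<le> stability_error"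
  shows "(\<Sum>t=s..K*n. perm_avg n (\<lambda>\<pi>. F (x \<pi> t)) - perm_avg n (\<lambda>\<pi>. F (u \<pi>)))
    \<le> perm_avg n (\<lambda>\<pi>. (norm (x \<pi> s - u \<pi>))\<^sup>2) / (2 * h)
      + real (K * n - s + 1) * (2 * stability_error + h / 2 * G2\<^sup>2)"
proof -
  let ?i = "single_shuffle n"
  let ?m = "K * n + 1 - s"
  have interval: "{s..K*n} = {s..<s+?m}"
    using s by auto
  have idx: "?i \<pi> t = \<pi> (cyclic_index n t)" for \<pi> t
    by (simp add: single_shuffle_def)
  have cyc: "cyclic_index n t \<in> {1..n}" if "t \<in> {s..K*n}" for t
    using s that by (intro cyclic_index_range[OF n_pos]) auto
  have G_avg: "perm_avg n (\<lambda>\<pi>. (G (?i \<pi> t))\<^sup>2) = G2\<^sup>2" if "t \<in> {s..K*n}" for t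
    unfolding idx perm_avg_component[OF cyc[OF that], of "\<lambda>i. (G i)\<^sup>2"] sum_G_square
    using n_pos by simp
  have "perm_avg n (\<lambda>\<pi>. 2 * h * (\<Sum>t=s..K*n. f (?i \<pi> t) (x \<pi> t) - f (?i \<pi> t) (u \<pi>)))
      \<le> perm_avg n (\<lambda>\<pi>. (norm (x \<pi> s - u \<pi>))\<^sup>2 + h\<^sup>2 * (\<Sum>t=s..K*n. (G (?i \<pi> t))\<^sup>2))"
  proof (rule perm_avg_mono)
    fix \<pi> assume \<pi>: "\<pi> permutes {1..n}"
    have "2 * h * (\<Sum>t=s..<s+?m. f (?i \<pi> t) (x \<pi> t) - f (?i \<pi> t) (u \<pi>))
      \<le> (norm (x \<pi> s - u \<pi>))\<^sup>2 - (norm (x \<pi> (s + ?m) - u \<pi>))\<^sup>2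
        + h\<^sup>2 * (\<Sum>t=s..<s+?m. (G (?i \<pi> t))\<^sup>2)"
      using s by (intro run_descent[OF runs[OF \<pi>] h_pos single_shuffle_range[OF \<pi>]] u[OF \<pi>]) auto
    also have "\<dots> \<le> (norm (x \<pi> s - u \<pi>))\<^sup>2 + h\<^sup>2 * (\<Sum>t=s..<s+?m. (G (?i \<pi> t))\<^sup>2)"
      by simp
    finally show "2 * h * (\<Sum>t=s..K*n. f (?i \<pi> t) (x \<pi> t) - f (?i \<pi> t) (u \<pi>))
        \<le> (norm (x \<pi> s - u \<pi>))\<^sup>2 + h\<^sup>2 * (\<Sum>t=s..K*n. (G (?i \<pi> t))\<^sup>2)"
      unfolding interval .
  qed
  also have "\<dots> = perm_avg n (\<lambda>\<pi>. (norm (x \<pi> s - u \<pi>))\<^sup>2) + h\<^sup>2 * (real (K * n - s + 1) * G2\<^sup>2)"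
    unfolding perm_avg_add perm_avg_cmult perm_avg_sum using s by (simp add: G_avg Suc_diff_le)
  finally have regret: "(\<Sum>t=s..K*n. perm_avg n (\<lambda>\<pi>. f (?i \<pi> t) (x \<pi> t)) - perm_avg n (\<lambda>\<pi>. f (?i \<pi> t) (u \<pi>)))
      \<le> perm_avg n (\<lambda>\<pi>. (norm (x \<pi> s - u \<pi>))\<^sup>2) / (2 * h) + real (K * n - s + 1) * (h / 2 * G2\<^sup>2)"
    unfolding perm_avg_cmult perm_avg_sum perm_avg_diff
    using h_pos by (simp add: field_simps power2_eq_square)
  have "(\<Sum>t=s..K*n. perm_avg n (\<lambda>\<pi>. F (x \<pi> t)) - perm_avg n (\<lambda>\<pi>. F (u \<pi>)))
      \<le> (\<Sum>t=s..K*n. perm_avg n (\<lambda>\<pi>. f (?i \<pi> t) (x \<pi> t)) - perm_avg n (\<lambda>\<pi>. f (?i \<pi> t) (u \<pi>))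
          + 2 * stability_error)"
  proof (rule sum_mono)
    fix t assume t: "t \<in> {s..K*n}"
    have "t \<in> {1..K*n+1}"
      using s t by auto
    with component_vs_mean[OF cyc[OF t]] unbiased[OF cyc[OF t]]
    show "perm_avg n (\<lambda>\<pi>. F (x \<pi> t)) - perm_avg n (\<lambda>\<pi>. F (u \<pi>))
        \<le> perm_avg n (\<lambda>\<pi>. f (?i \<pi> t) (x \<pi> t)) - perm_avg n (\<lambda>\<pi>. f (?i \<pi> t) (u \<pi>)) + 2 * stability_error"
      unfolding idx perm_avg_diff by (fastforce simp: abs_le_iff)
  qed
  also have "\<dots> = (\<Sum>t=s..K*n. perm_avg n (\<lambda>\<pi>. f (?i \<pi> t) (x \<pi> t)) - perm_avg n (\<lambda>\<pi>. f (?i \<pi> t) (u \<pi>)))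
      + real (K * n - s + 1) * (2 * stability_error)"
    using s by (simp add: sum.distrib Suc_diff_le)
  finally show ?thesis
    using regret by (simp add: distrib_left)
qed

text \<open>
  The hypothesis gives \<open>K G2\<^sup>2 \<le> sqrt (n K) G1 G2\<close>, which absorbs the part of the stability error
  caused by the exchanged components. The constant is twice \<open>2 * 6 + 1 / 2\<close>, from the stability
  error and the squared subgradients, plus 1 for the step from iterate \<open>K n\<close> to \<open>K n + 1\<close>.
\<close>

lemma average_last_iterate:
  assumes few_passes: "real K * G2 \<le> sqrt (real (n * K)) * G1" and z: "z \<in> C"
  shows "perm_avg n (\<lambda>\<pi>. F (x \<pi> (K * n + 1)) - F z)
    \<le> (norm (x1 - z))\<^sup>2 / (2 * h * real (n * K))
      + 26 * h * (sqrt (real (n * K)) * G1 * G2) * (1 + ln (real (n * K)))"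
proof -
  define M where "M = sqrt (real (n * K)) * G1 * G2"
  define a where "a t = perm_avg n (\<lambda>\<pi>. F (x \<pi> t))" for t
  define E where "E = 2 * stability_error + h / 2 * G2\<^sup>2"
  have N: "K * n \<ge> 1" "n * K \<ge> 1"
    using n_pos K_pos by (auto simp: Suc_le_eq)
  have G2_pos: "G2 > 0"
    using G1_pos G1_le_G2 by simp
  have KG2: "real K * G2\<^sup>2 \<le> M"
    using mult_right_mono[OF few_passes, of G2] G2_pos by (simp add: M_def power2_eq_square mult_ac)
  have G2_sq: "G2\<^sup>2 \<le> M"
    using KG2 mult_right_mono[of 1 "real K" "G2\<^sup>2"] K_pos by simp
  have G1_sq: "G1\<^sup>2 \<le> G2\<^sup>2"
    using G1_pos G1_le_G2 by (intro power_mono) auto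
  have "real K * (G2\<^sup>2 + G1\<^sup>2) \<le> real K * (2 * G2\<^sup>2)"
    using G1_sq by (intro mult_left_mono) auto
  then have "real K * (G2\<^sup>2 + G1\<^sup>2) \<le> 2 * M"
    using KG2 by simp
  then have "2 * h * (real K * (G2\<^sup>2 + G1\<^sup>2)) \<le> 2 * h * (2 * M)"
    using h_pos by (intro mult_left_mono) auto
  then have stab: "stability_error \<le> 6 * h * M"
    by (simp add: stability_error_def M_def algebra_simps)
  have "h / 2 * G2\<^sup>2 \<le> h / 2 * M"
    using G2_sq h_pos by (intro mult_left_mono) auto
  then have E: "E \<le> 25 / 2 * (h * M)"
    using stab by (simp add: E_def)
  have E_nonneg: "E \<ge> 0"
    using stability_error_nonneg h_pos by (simp add: E_def)
  have last_step: "a (K * n + 1) - a (K * n) \<le> h * M"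
  proof -
    have "a (K * n + 1) - a (K * n) = perm_avg n (\<lambda>\<pi>. F (x \<pi> (K * n + 1)) - F (x \<pi> (K * n)))"
      by (simp add: a_def perm_avg_diff)
    also have "\<dots> \<le> perm_avg n (\<lambda>\<pi>. (G1 * h) * G (\<pi> (cyclic_index n (K * n))))"
    proof (rule perm_avg_mono)
      fix \<pi> assume \<pi>: "\<pi> permutes {1..n}"
      have "F (x \<pi> (K * n + 1)) - F (x \<pi> (K * n)) \<le> G1 * norm (x \<pi> (K * n + 1) - x \<pi> (K * n))"
        using N by (intro F_diff_le run_in_C[OF runs[OF \<pi>]]) auto
      also have "\<dots> \<le> G1 * (h * (\<Sum>t=K*n..<K*n+1. G (single_shuffle n \<pi> t)))"
        using N G1_pos
        by (intro mult_left_mono run_movement[OF runs[OF \<pi>] h_pos single_shuffle_range[OF \<pi>]]) auto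
      finally show "F (x \<pi> (K * n + 1)) - F (x \<pi> (K * n)) \<le> (G1 * h) * G (\<pi> (cyclic_index n (K * n)))"
        by (simp add: single_shuffle_def)
    qed
    also have "\<dots> = h * G1\<^sup>2"
      unfolding perm_avg_cmult perm_avg_component[OF cyclic_index_range[OF n_pos N(1)], of G] sum_G
      using n_pos by (simp add: power2_eq_square)
    also have "\<dots> \<le> h * M"
      using G1_sq G2_sq h_pos by (intro mult_left_mono) auto
    finally show ?thesis .
  qed
  have "a (K * n) - F z \<le> ((norm (x1 - z))\<^sup>2 / (2 * h)) / real (K * n) + 2 * E * (1 + ln (real (K * n)))"
  proof (rule last_iterate_bound[OF N(1) E_nonneg])
    fix s assume s: "s \<in> {1..K*n}"
    have "perm_avg n (\<lambda>\<pi>. f (\<pi> p) (x \<pi> s) - F (x \<pi> s)) \<le> stability_error" if "p \<in> {1..n}" for p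
      using component_vs_mean[OF that, of s] s by simp
    then show "(\<Sum>t=s..K*n. a t - a s) \<le> real (K * n - s + 1) * E"
      using average_descent[OF s, of "\<lambda>\<pi>. x \<pi> s"] s run_in_C[OF runs]
      by (simp add: a_def E_def perm_avg_const)
  next
    have "perm_avg n (\<lambda>\<pi>. f (\<pi> p) z - F z) = 0" if "p \<in> {1..n}" for p
      using perm_avg_component[OF that, of "\<lambda>i. f i z"] by (simp add: perm_avg_diff perm_avg_const F_def)
    then have "(\<Sum>t=1..K*n. a t - perm_avg n (\<lambda>_. F z))
        \<le> perm_avg n (\<lambda>\<pi>. (norm (x \<pi> 1 - z))\<^sup>2) / (2 * h) + real (K * n - 1 + 1) * E"
      unfolding a_def E_def
      using average_descent[of 1 "\<lambda>_. z"] z N stability_error_nonneg by simp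
    moreover have "perm_avg n (\<lambda>\<pi>. (norm (x \<pi> 1 - z))\<^sup>2) = perm_avg n (\<lambda>_. (norm (x1 - z))\<^sup>2)"
      by (rule perm_avg_cong) (simp only: start)
    ultimately show "(\<Sum>t=1..K*n. a t - F z) \<le> (norm (x1 - z))\<^sup>2 / (2 * h) + real (K * n) * E"
      using N by (simp add: perm_avg_const)
  qed
  also have "2 * E * (1 + ln (real (K * n))) \<le> 25 * (h * M) * (1 + ln (real (K * n)))"
    using E ln_ge_zero[of "real (K * n)"] N(1) by (intro mult_right_mono) (auto simp del: of_nat_mult)
  finally have "a (K * n) - F z
      \<le> (norm (x1 - z))\<^sup>2 / (2 * h * real (n * K)) + 25 * (h * M) * (1 + ln (real (n * K)))"
    by (simp add: mult_ac)
  moreover have "h * M \<le> h * M * (1 + ln (real (n * K)))"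
  proof -
    have "1 \<le> 1 + ln (real (n * K))"
      using N(2) by (metis le_add_same_cancel1 ln_ge_zero of_nat_1 of_nat_mono)
    moreover have "0 \<le> h * M"
      using h_pos order_trans[OF zero_le_power2 G2_sq] by simp
    ultimately show ?thesis
      using mult_left_mono[of 1 "1 + ln (real (n * K))" "h * M"] by simp
  qed
  moreover have "perm_avg n (\<lambda>\<pi>. F (x \<pi> (K * n + 1)) - F z) = a (K * n + 1) - F z"
    by (simp add: a_def perm_avg_diff perm_avg_const)
  ultimately show ?thesis
    using last_step unfolding M_def[symmetric] by (simp add: algebra_simps)
qed

end


section \<open>The rate and its optimal stepsize\<close>

text \<open>
  If the first term of the minimum is the smaller one then \<open>sqrt (n K) G2 \<le> n G1\<close>, which is the
  hypothesis \<open>K G2 \<le> sqrt (n K) G1\<close> of the averaged bound up to the factor \<open>sqrt (n / K)\<close>.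
\<close>

lemma (in shuffled_runs) average_bound_min:
  assumes z: "z \<in> C"
  shows "perm_avg n (\<lambda>\<pi>. F (x \<pi> (K * n + 1)) - F z)
    \<le> (norm (z - x1))\<^sup>2 / (2 * h * real (n * K)) + 26 * h * ss_factor n K G"
proof -
  define L where "L = 1 + ln (real (n * K))"
  have N: "n * K \<ge> 1"
    using n_pos K_pos by (auto simp: Suc_le_eq)
  have ln_K: "ln (real K) \<le> ln (real (n * K))"
    using n_pos K_pos by (intro ln_mono) auto
  have factor: "ss_factor n K G = min (sqrt (real (n * K)) * G1 * G2) (real n * G1\<^sup>2) * L"
    by (simp add: ss_factor_def L_def)
  show ?thesis
  proof (cases "sqrt (real (n * K)) * G1 * G2 \<le> real n * G1\<^sup>2")
    case True
    then have "G1 * (sqrt (real (n * K)) * G2) \<le> G1 * (real n * G1)"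
      by (simp add: power2_eq_square mult_ac)
    then have "sqrt (real (n * K)) * G2 \<le> real n * G1"
      using G1_pos by (simp only: mult_le_cancel_left_pos)
    then have "sqrt (real (n * K)) * (sqrt (real (n * K)) * G2) \<le> sqrt (real (n * K)) * (real n * G1)"
      by (intro mult_left_mono) auto
    then have "real n * (real K * G2) \<le> real n * (sqrt (real (n * K)) * G1)"
      by (simp add: mult_ac flip: mult.assoc[of "sqrt _" "sqrt _"])
    then have "real K * G2 \<le> sqrt (real (n * K)) * G1"
      using n_real_pos by (simp only: mult_le_cancel_left_pos)
    from average_last_iterate[OF this z] True show ?thesis
      by (simp add: factor L_def norm_minus_commute mult_ac)
  next
    case False
    have "perm_avg n (\<lambda>\<pi>. F (x \<pi> (K * n + 1)) - F z)
        \<le> perm_avg n (\<lambda>_. (norm (x1 - z))\<^sup>2 / (2 * h * real (n * K)) + 4 * h * real n * G1\<^sup>2 * (1 + ln (real K)))"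
    proof (rule perm_avg_mono)
      fix \<pi> assume \<pi>: "\<pi> permutes {1..n}"
      from any_order_last_iterate[OF \<pi> runs[OF \<pi>] h_pos K_pos z]
      show "F (x \<pi> (K * n + 1)) - F z
          \<le> (norm (x1 - z))\<^sup>2 / (2 * h * real (n * K)) + 4 * h * real n * G1\<^sup>2 * (1 + ln (real K))"
        unfolding start[OF \<pi>] .
    qed
    also have "4 * h * real n * G1\<^sup>2 * (1 + ln (real K)) \<le> 26 * h * real n * G1\<^sup>2 * L"
      unfolding L_def using h_pos ln_K K_pos by (intro mult_mono) auto
    finally show ?thesis
      using False by (simp add: perm_avg_const factor norm_minus_commute min_def mult_ac)
  qed
qed

lemma (in component_subgradients) ss_factor_pos:
  assumes "K \<ge> 1"
  shows "ss_factor n K G > 0"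
proof -
  have N: "n * K \<ge> 1"
    using n_pos assms by (auto simp: Suc_le_eq)
  then have "1 + ln (real (n * K)) > 0"
    by (metis add_pos_nonneg ln_ge_zero of_nat_1 of_nat_mono zero_less_one)
  moreover have "G2 > 0"
    using G1_pos G1_le_G2 by simp
  ultimately show ?thesis
    using N n_pos G1_pos unfolding ss_factor_def
    by (intro mult_pos_pos) (auto simp del: of_nat_mult)
qed

lemma is_arg_min_balance:
  fixes a b c :: real
  assumes "a > 0" "b > 0" "c > 0"
  shows "is_arg_min (\<lambda>\<eta>. (a\<^sup>2 / \<eta> + \<eta> * b) * c) (\<lambda>\<eta>. \<eta> > 0) (a / sqrt b)"
  unfolding is_arg_min_linorder
proof (intro conjI allI impI)
  show "a / sqrt b > 0"
    using assms by simp
  fix \<eta> :: real assume \<eta>: "\<eta> > 0"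
  have sqrt_b: "sqrt b * sqrt b = b" "sqrt b > 0"
    using assms by auto
  have "a\<^sup>2 / (a / sqrt b) + a / sqrt b * b = 2 * a * sqrt b"
    using assms sqrt_b by (simp add: field_simps power2_eq_square)
  also have "\<dots> \<le> a\<^sup>2 / \<eta> + \<eta> * b"
  proof -
    have "a\<^sup>2 / \<eta> + \<eta> * b - 2 * a * sqrt b = (a - \<eta> * sqrt b)\<^sup>2 / \<eta>"
      using \<eta> sqrt_b by (simp add: field_simps power2_eq_square)
    moreover have "\<dots> \<ge> 0"
      using \<eta> by simp
    ultimately show ?thesis by linarith
  qed
  finally show "(a\<^sup>2 / (a / sqrt b) + a / sqrt b * b) * c \<le> (a\<^sup>2 / \<eta> + \<eta> * b) * c"
    using assms by (intro mult_right_mono) auto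
qed

theorem theoremA5:
  shows "\<exists>c>0 :: real. \<forall>(d :: nat) (n :: nat) (K :: nat)
      (f :: nat \<Rightarrow> finseq \<Rightarrow> real) (g :: nat \<Rightarrow> finseq \<Rightarrow> finseq) (G :: nat \<Rightarrow> real)
      (C :: finseq set) (\<eta> :: real) (x1 :: finseq)
      (x :: (nat \<Rightarrow> nat) \<Rightarrow> nat \<Rightarrow> finseq) (z :: finseq).
    d \<ge> 1 \<and> n \<ge> 1 \<and> K \<ge> 1 \<and>
    C \<subseteq> Rd d \<and> C \<noteq> {} \<and> closed C \<and> convex C \<and>
    (\<forall>i\<in>{1..n}. convex_on (Rd d) (f i)) \<and>
    (\<forall>i\<in>{1..n}. \<forall>y\<in>Rd d. g i y \<in> subdifferential d (f i) y) \<and>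
    (\<forall>i\<in>{1..n}. G i > 0 \<and> lipschitz_on (G i) C (f i) \<and> (\<forall>y\<in>C. norm (g i y) \<le> G i)) \<and>
    \<eta> > 0 \<and>
    (\<forall>\<pi>. \<pi> permutes {1..n} \<longrightarrow>
       x \<pi> 1 = x1 \<and>
       proximal_gradient d (convex_indicator C) g (single_shuffle n \<pi>)
         (\<lambda>t. \<eta> / sqrt (real (K * n))) (K * n) (x \<pi>)) \<and>
    z \<in> Rd d
    \<longrightarrow>
    ereal_expectation (measure_pmf (uniform_permutation n))
      (\<lambda>\<pi>. objective n f (convex_indicator C) (x \<pi> (K * n + 1))
           - objective n f (convex_indicator C) z)
      \<le> ereal (c * ss_rate n K G (norm (z - x1)) \<eta>) \<and>
    (z \<noteq> x1 \<longrightarrow>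
       is_arg_min (ss_rate n K G (norm (z - x1))) (\<lambda>\<eta>'. \<eta>' > 0)
         (norm (z - x1) / sqrt (ss_factor n K G)))"
proof (intro exI[of _ 26] conjI allI impI)
  fix d n K f g G C \<eta> x1 x and z :: finseq
  assume asm: "d \<ge> 1 \<and> n \<ge> 1 \<and> K \<ge> 1 \<and>
    C \<subseteq> Rd d \<and> C \<noteq> {} \<and> closed C \<and> convex C \<and>
    (\<forall>i\<in>{1..n}. convex_on (Rd d) (f i)) \<and>
    (\<forall>i\<in>{1..n}. \<forall>y\<in>Rd d. g i y \<in> subdifferential d (f i) y) \<and>
    (\<forall>i\<in>{1..n}. G i > 0 \<and> lipschitz_on (G i) C (f i) \<and> (\<forall>y\<in>C. norm (g i y) \<le> G i)) \<and>
    \<eta> > 0 \<and>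
    (\<forall>\<pi>. \<pi> permutes {1..n} \<longrightarrow>
       x \<pi> 1 = x1 \<and>
       proximal_gradient d (convex_indicator C) g (single_shuffle n \<pi>)
         (\<lambda>t. \<eta> / sqrt (real (K * n))) (K * n) (x \<pi>)) \<and>
    z \<in> Rd d"
  define h where "h = \<eta> / sqrt (real (K * n))"
  define N where "N = real (n * K)"
  have n: "n \<ge> 1" and K: "K \<ge> 1" and C: "C \<subseteq> Rd d" "convex C" and \<eta>: "\<eta> > 0"
    using asm by auto
  have N: "N > 0"
    using n K by (auto simp: N_def)
  have h: "h > 0" "h = \<eta> / sqrt N"
    using \<eta> n K by (auto simp: h_def N_def mult.commute)
  have prox_run: "proximal_gradient d (convex_indicator C) g (single_shuffle n \<pi>) (\<lambda>_. h) (K * n) (x \<pi>)"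
    if "\<pi> permutes {1..n}" for \<pi>
    using asm that unfolding h_def by blast
  interpret component_subgradients C n f g G
  proof
    show "f i y + inner (g i y) (u - y) \<le> f i u" if "i \<in> {1..n}" "y \<in> C" "u \<in> C" for i y u
      using asm that C(1) unfolding subdifferential_def by blast
  qed (use asm in auto)
  interpret shuffled_runs C n f g G h K x1 x
  proof
    show "run (single_shuffle n \<pi>) h (K * n) (x \<pi>)" if "\<pi> permutes {1..n}" for \<pi>
      using proximal_gradient_indicator[OF C(2,1) h(1) prox_run[OF that]] by (auto simp: run_def)
    show "x \<pi> 1 = x1" if "\<pi> permutes {1..n}" for \<pi>
      using asm that by blast
  qed (fact h K)+
  have x_C: "x \<pi> (K * n + 1) \<in> C" if "\<pi> permutes {1..n}" for \<pi>
    by (rule run_in_C[OF runs[OF that]]) simp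
  have objective_C: "objective n f (convex_indicator C) y = ereal (F y)" if "y \<in> C" for y
    using that by (simp add: objective_def convex_indicator_def F_def)
  let ?gap = "\<lambda>\<pi>. objective n f (convex_indicator C) (x \<pi> (K * n + 1)) - objective n f (convex_indicator C) z"
  show "ereal_expectation (measure_pmf (uniform_permutation n)) ?gap
      \<le> ereal (26 * ss_rate n K G (norm (z - x1)) \<eta>)"
  proof (cases "z \<in> C")
    case True
    have "ereal_expectation (measure_pmf (uniform_permutation n)) ?gap
        = ereal (perm_avg n (\<lambda>\<pi>. F (x \<pi> (K * n + 1)) - F z))"
      using x_C True by (intro ereal_expectation_uniform_permutation) (simp add: objective_C)
    moreover have "(norm (z - x1))\<^sup>2 / (2 * h * N) + 26 * h * ss_factor n K G
        \<le> 26 * ss_rate n K G (norm (z - x1)) \<eta>"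
    proof -
      have "h * N = \<eta> * sqrt N"
        using N real_div_sqrt[of N] by (simp add: h(2) flip: times_divide_eq_right)
      then have "(norm (z - x1))\<^sup>2 / (2 * h * N) = 1 / 2 * ((norm (z - x1))\<^sup>2 / (\<eta> * sqrt N))"
        by (simp add: mult.assoc)
      also have "\<dots> \<le> 26 * ((norm (z - x1))\<^sup>2 / (\<eta> * sqrt N))"
        using \<eta> N by (intro mult_right_mono) auto
      also have "26 * ((norm (z - x1))\<^sup>2 / (\<eta> * sqrt N)) + 26 * h * ss_factor n K G
          = 26 * ss_rate n K G (norm (z - x1)) \<eta>"
        unfolding ss_rate_def N_def[symmetric] h(2) by (simp add: algebra_simps)
      finally show ?thesis by simp
    qed
    ultimately show ?thesis
      using average_bound_min[OF True] by (simp add: N_def[symmetric] del: of_nat_mult)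
  next
    case False
    have "?gap \<pi> = - \<infinity>" if "\<pi> permutes {1..n}" for \<pi>
      using x_C[OF that] False by (simp add: objective_def convex_indicator_def)
    from ereal_expectation_uniform_permutation_minf[OF this] show ?thesis
      by simp
  qed
  show "is_arg_min (ss_rate n K G (norm (z - x1))) (\<lambda>\<eta>'. \<eta>' > 0)
      (norm (z - x1) / sqrt (ss_factor n K G))" if "z \<noteq> x1"
    unfolding ss_rate_def[abs_def] N_def[symmetric]
    using that N ss_factor_pos[OF K] by (intro is_arg_min_balance) auto
qed simp

end
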